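(* Let $0<\underline{\sigma}\le\overline{\sigma}<\infty$. Let $w(t,x)$ be the solution of the Cauchy problem $$w_t = \tfrac12\left(\overline{\sigma}^2 (w_{xx})^+ - \underline{\sigma}^2 (w_{xx})^-\right),\qquad w(0,x) = \mathbf{1}(|x|>c).$$ Let $u(t,x)=f\{(x-c)/\sqrt t\}$ and $v(t,x)=f\{(-x-c)/\sqrt t\}$ for $t>0$, with $u(0,x)=\mathbf{1}(x>c)$ and $v(0,x)=\mathbf{1}(x<-c)$, where $$f(y) = \frac{2}{\overline{\sigma}+\underline{\sigma}} \int_{-y}^{\infty} \left\{ \phi(z/\overline{\sigma})\,\mathbf{1}(z\ge 0) + \phi(z/\underline{\sigma})\,\mathbf{1}(z<0)\right\} dz .$$ For any $x\in\mathbb{R}$ and $t\ge 0$, if $c>\overline{\sigma}\sqrt t/2$, then $$0\le u(t,x)+v(t,x)-w(t,x)\le \frac{2(\overline{\sigma}-\underline{\sigma})}{\overline{\sigma}}\,\Phi\left(-\frac{2c}{\overline{\sigma}\sqrt t}\right),$$ where for $t=0$ the right-hand side is read as $0$.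
   Context: $\phi$ and $\Phi$ are the standard normal density and distribution function, $\mathbf{1}(\cdot)$ is the indicator, and $a^+=\max(a,0)$, $a^-=\max(-a,0)$. The equation $u_t = \frac12(\overline{\sigma}^2 (u_{xx})^+ - \underline{\sigma}^2 (u_{xx})^-)$ on $(0,\infty)\times\mathbb{R}$ is called the G-heat equation. For an initial datum $\varphi$ that is an indicator function with finitely many jumps, "the solution" of the Cauchy problem with $u(0,x)=\varphi(x)$ means the unique bounded function $u$ that is continuous on $(0,\infty)\times\mathbb{R}$, is a viscosity solution of the equation there, equals $\varphi$ at $t=0$, and satisfies $u(t,x)\to\varphi(x_0)$ as $(t,x)\to(0^+,x_0)$ at every continuity point $x_0$ of $\varphi$. The functions $u$ and $v$ in the claim are the solutions of the G-heat equation with initial data $\mathbf{1}(x>c)$ and $\mathbf{1}(x<-c)$ respectively. *)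

theory Defs
  imports "HOL-Probability.Probability"
begin

text \<open>The nonlinearity of the G-heat equation \<open>u\<^sub>t = G u\<^sub>x\<^sub>x\<close>, with volatility bounds
  \<open>\<sigma>lo \<le> \<sigma>hi\<close>.\<close>

definition G_fun :: "real \<Rightarrow> real \<Rightarrow> real \<Rightarrow> real" where
  "G_fun \<sigma>lo \<sigma>hi a = 1/2 * (\<sigma>hi\<^sup>2 * max a 0 - \<sigma>lo\<^sup>2 * max (- a) 0)"

text \<open>\<open>\<psi>\<close> is of class \<open>C\<^sup>1\<^sup>,\<^sup>2\<close> on \<open>(0,\<infinity>) \<times> \<real>\<close> (once in time, twice in space), with
  \<open>p\<close>, \<open>q\<close>, \<open>r\<close> being \<open>\<psi>\<^sub>t\<close>, \<open>\<psi>\<^sub>x\<close>, \<open>\<psi>\<^sub>x\<^sub>x\<close>. Values at times \<open>t \<le> 0\<close> are irrelevant.\<close>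

definition C12_on_halfspace ::
  "(real \<Rightarrow> real \<Rightarrow> real) \<Rightarrow> (real \<Rightarrow> real \<Rightarrow> real) \<Rightarrow> (real \<Rightarrow> real \<Rightarrow> real)
    \<Rightarrow> (real \<Rightarrow> real \<Rightarrow> real) \<Rightarrow> bool" where
  "C12_on_halfspace \<psi> p q r \<longleftrightarrow>
     (\<forall>t>0. \<forall>x.
        ((\<lambda>s. \<psi> s x) has_real_derivative p t x) (at t) \<and>
        ((\<lambda>y. \<psi> t y) has_real_derivative q t x) (at x) \<and>
        ((\<lambda>y. q t y) has_real_derivative r t x) (at x)) \<and>
     continuous_on ({0<..} \<times> UNIV) (\<lambda>(t, x). \<psi> t x) \<and>
     continuous_on ({0<..} \<times> UNIV) (\<lambda>(t, x). p t x) \<and>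
     continuous_on ({0<..} \<times> UNIV) (\<lambda>(t, x). q t x) \<and>
     continuous_on ({0<..} \<times> UNIV) (\<lambda>(t, x). r t x)"

definition gheat_viscosity_subsolution :: "real \<Rightarrow> real \<Rightarrow> (real \<Rightarrow> real \<Rightarrow> real) \<Rightarrow> bool" where
  "gheat_viscosity_subsolution \<sigma>lo \<sigma>hi u \<longleftrightarrow>
     (\<forall>\<psi> p q r t x. C12_on_halfspace \<psi> p q r \<and> t > 0 \<and>
        (\<forall>\<^sub>F (s, y) in nhds (t, x). u s y - \<psi> s y \<le> u t x - \<psi> t x)
        \<longrightarrow> p t x \<le> G_fun \<sigma>lo \<sigma>hi (r t x))"

definition gheat_viscosity_supersolution :: "real \<Rightarrow> real \<Rightarrow> (real \<Rightarrow> real \<Rightarrow> real) \<Rightarrow> bool" where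
  "gheat_viscosity_supersolution \<sigma>lo \<sigma>hi u \<longleftrightarrow>
     (\<forall>\<psi> p q r t x. C12_on_halfspace \<psi> p q r \<and> t > 0 \<and>
        (\<forall>\<^sub>F (s, y) in nhds (t, x). u s y - \<psi> s y \<ge> u t x - \<psi> t x)
        \<longrightarrow> p t x \<ge> G_fun \<sigma>lo \<sigma>hi (r t x))"

definition gheat_viscosity_solution :: "real \<Rightarrow> real \<Rightarrow> (real \<Rightarrow> real \<Rightarrow> real) \<Rightarrow> bool" where
  "gheat_viscosity_solution \<sigma>lo \<sigma>hi u \<longleftrightarrow>
     continuous_on ({0<..} \<times> UNIV) (\<lambda>(t, x). u t x) \<and>
     gheat_viscosity_subsolution \<sigma>lo \<sigma>hi u \<and>
     gheat_viscosity_supersolution \<sigma>lo \<sigma>hi u"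

text \<open>The initial datum \<open>\<phi>\<close> may jump, so the initial value is attained as a limit only at its
  continuity points. Values of \<open>u\<close> at negative times are not constrained.\<close>

definition gheat_cauchy_solution ::
  "real \<Rightarrow> real \<Rightarrow> (real \<Rightarrow> real) \<Rightarrow> (real \<Rightarrow> real \<Rightarrow> real) \<Rightarrow> bool" where
  "gheat_cauchy_solution \<sigma>lo \<sigma>hi \<phi> u \<longleftrightarrow>
     bounded ((\<lambda>(t, x). u t x) ` ({0..} \<times> UNIV)) \<and>
     gheat_viscosity_solution \<sigma>lo \<sigma>hi u \<and>
     (\<forall>x. u 0 x = \<phi> x) \<and>
     (\<forall>x\<^sub>0. isCont \<phi> x\<^sub>0 \<longrightarrow>
        ((\<lambda>(t, x). u t x) \<longlongrightarrow> \<phi> x\<^sub>0) (at (0, x\<^sub>0) within {0<..} \<times> UNIV))"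

definition f_profile :: "real \<Rightarrow> real \<Rightarrow> real \<Rightarrow> real" where
  "f_profile \<sigma>lo \<sigma>hi y =
     2 / (\<sigma>hi + \<sigma>lo) *
     (LINT z:{- y..}|lborel.
        std_normal_density (z / \<sigma>hi) * of_bool (z \<ge> 0) +
        std_normal_density (z / \<sigma>lo) * of_bool (z < 0))"

abbreviation std_normal_cdf :: "real \<Rightarrow> real" where
  "std_normal_cdf \<equiv> cdf std_normal_distribution"

end

theory Submission
  imports Defs
begin

text \<open>
  By sublinearity of \<open>G\<close>, \<open>u + v\<close> is a classical supersolution with the initial datum of \<open>w\<close>,
  which gives \<open>w \<le> u + v\<close>.  For the other inequality, let \<open>E t\<close> be the claimed bound, which equals
  \<open>(1 - \<sigma>lo\<^sup>2 / \<sigma>hi\<^sup>2) v(t, c)\<close>.  Additivity of \<open>G\<close> fails only where \<open>u\<close> and \<open>v\<close> have opposite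
  convexity, that is for \<open>\<bar>x\<bar> > c\<close>; there the defect is at most
  \<open>(\<sigma>hi\<^sup>2 - \<sigma>lo\<^sup>2) / 2\<close> times the second derivative of the convex summand.  That derivative is a
  multiple of \<open>\<xi> \<phi>(\<xi>)\<close> with \<open>\<xi> = (\<bar>x\<bar> + c) / (\<sigma>hi \<surd>t)\<close>, which decreases for \<open>\<xi> \<ge> 1\<close>; since
  \<open>2 c > \<sigma>hi \<surd>t\<close> it is largest at \<open>\<bar>x\<bar> = c\<close>, where the bound on the defect is exactly the time
  derivative of \<open>E\<close>.  Hence \<open>u + v - E\<close> is a classical subsolution.

  Both comparisons are between a viscosity and a classical semisolution, so no doubling of variables
  is needed.  The jumps of the initial datum at \<open>\<plusminus>c\<close> are handled by a penalty that is a strict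
  supersolution and blows up at \<open>(0, \<plusminus>c)\<close> as well as at spatial infinity.
\<close>

section \<open>The standard normal distribution function\<close>

lemma integrable_std_normal_density: "integrable lborel std_normal_density"
  by (rule integrable_normal_density) simp

lemma std_normal_cdf_eq_LINT:
  "std_normal_cdf x = (LINT z:{..x}|lborel. std_normal_density z)"
proof -
  have "ennreal (std_normal_cdf x) = ennreal (LINT z:{..x}|lborel. std_normal_density z)"
  proof -
    interpret real_distribution std_normal_distribution
      by (rule real_dist_normal_dist)
    have "ennreal (std_normal_cdf x) = emeasure std_normal_distribution {..x}"
      by (simp add: cdf_def emeasure_eq_measure)
    also have "\<dots> = (\<integral>\<^sup>+z. ennreal (std_normal_density z * indicator {..x} z) \<partial>lborel)"
      by (subst emeasure_density)
        (auto intro!: nn_integral_cong simp: indicator_def split: if_splits)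
    also have "\<dots> = ennreal (LINT z|lborel. std_normal_density z * indicator {..x} z)"
      by (rule nn_integral_eq_integral)
        (auto intro!: integrable_real_mult_indicator integrable_std_normal_density)
    finally show ?thesis
      by (simp add: set_lebesgue_integral_def mult.commute)
  qed
  then show ?thesis
    by (subst (asm) ennreal_inj)
      (auto simp: cdf_def set_lebesgue_integral_def intro!: integral_nonneg_AE)
qed

lemma std_normal_density_minus: "std_normal_density (- x) = std_normal_density x"
  by (simp add: std_normal_density_def)

lemma continuous_on_std_normal_density [continuous_intros]:
  "continuous_on S g \<Longrightarrow> continuous_on S (\<lambda>x. std_normal_density (g x))"
  unfolding std_normal_density_def by (intro continuous_intros) auto

lemma DERIV_std_normal_density:
  "(std_normal_density has_real_derivative - x * std_normal_density x) (at x)"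
  unfolding std_normal_density_def[abs_def]
  by (auto intro!: derivative_eq_intros simp: field_simps)

text \<open>Near \<open>x\<close> the distribution function is a constant plus an integral over a
  compact interval with variable upper end, so the fundamental theorem of calculus applies. The
  window from \<open>x - 1\<close> to \<open>x + 1\<close> keeps \<open>x\<close> interior, which
  turns the derivative within the window into a full one.\<close>

lemma DERIV_std_normal_cdf:
  "(std_normal_cdf has_real_derivative std_normal_density x) (at x)"
proof -
  let ?f = std_normal_density
  let ?a = "x - 1" and ?b = "x + 1"
  have si: "set_integrable lborel S ?f" if "S \<in> sets borel" for S
    using integrable_real_mult_indicator[OF _ integrable_std_normal_density, of S] that
    by (simp add: set_integrable_def mult.commute)
  have eq: "std_normal_cdf y = std_normal_cdf ?a + integral {?a..y} ?f"
    if "y \<in> {?a..?b}" for y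
  proof -
    have "{..y} = {..?a} \<union> {?a<..y}"
      using that by auto
    moreover have "(LINT z:{..?a} \<union> {?a<..y}|lborel. ?f z) =
        (LINT z:{..?a}|lborel. ?f z) + (LINT z:{?a<..y}|lborel. ?f z)"
    proof (rule set_integral_Un)
      show "{..?a} \<inter> {?a<..y} = {}" by auto
    qed (rule si, simp)+
    ultimately have "(LINT z:{..y}|lborel. ?f z) =
        (LINT z:{..?a}|lborel. ?f z) + (LINT z:{?a<..y}|lborel. ?f z)"
      by (simp only:)
    also have "(LINT z:{?a<..y}|lborel. ?f z) = integral {?a<..y} ?f"
      by (rule set_borel_integral_eq_integral) (simp add: si)
    also have "\<dots> = integral {?a..y} ?f"
    proof (rule integral_subset_negligible)
      show "negligible ({?a..y} - {?a<..y})"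
        by (rule negligible_subset[OF negligible_sing, of _ ?a]) auto
    qed auto
    finally show ?thesis
      by (simp add: std_normal_cdf_eq_LINT)
  qed
  have "((\<lambda>y. integral {?a..y} ?f) has_real_derivative ?f x) (at x within {?a..?b})"
    by (rule integral_has_real_derivative)
      (simp_all add: continuous_on_std_normal_density[OF continuous_on_id])
  from DERIV_add[OF DERIV_const this]
  have "((\<lambda>y. std_normal_cdf ?a + integral {?a..y} ?f) has_real_derivative 0 + ?f x)
      (at x within {?a..?b})" .
  then have "(std_normal_cdf has_real_derivative ?f x) (at x within {?a..?b})"
    unfolding add_0
    by (rule has_field_derivative_transform_within[OF _ zero_less_one]) (simp, erule eq[symmetric])
  moreover have "at x within {?a..?b} = at x"
    by (rule at_within_Icc_at) simp_all
  ultimately show ?thesis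
    by (simp only:)
qed

lemma std_normal_cdf_at_top: "(std_normal_cdf \<longlongrightarrow> 1) at_top"
  by (rule real_distribution.cdf_lim_at_top_prob[OF real_dist_normal_dist])

lemma std_normal_cdf_at_bot: "(std_normal_cdf \<longlongrightarrow> 0) at_bot"
  using real_distribution.finite_borel_measure_M[OF real_dist_normal_dist]
  by (rule finite_borel_measure.cdf_lim_at_bot)

text \<open>The density is even, so \<Phi>(x) + \<Phi>(-x) has derivative zero; its constant value
  is the limit at infinity.\<close>

lemma std_normal_cdf_minus: "std_normal_cdf (- x) = 1 - std_normal_cdf x"
proof -
  let ?s = "\<lambda>x. std_normal_cdf x + std_normal_cdf (- x)"
  have "(?s has_real_derivative 0) (at y)" for y
    by (auto intro!: derivative_eq_intros DERIV_std_normal_cdf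
        DERIV_chain2[OF DERIV_std_normal_cdf] simp: std_normal_density_minus)
  then have const: "?s y = ?s x" for y
    by (intro DERIV_isconst_all) auto
  have "(?s \<longlongrightarrow> 1 + 0) at_top"
    by (intro tendsto_add std_normal_cdf_at_top
        filterlim_compose[OF std_normal_cdf_at_bot filterlim_uminus_at_bot_at_top])
  moreover have "(?s \<longlongrightarrow> ?s x) at_top"
    by (subst const) simp
  ultimately have "1 + 0 = ?s x"
    using tendsto_unique trivial_limit_at_top_linorder by blast
  then show ?thesis by simp
qed

lemma std_normal_cdf_0: "std_normal_cdf 0 = 1 / 2"
  using std_normal_cdf_minus[of 0] by simp

lemma set_integrable_scaled_std_normal_density:
  assumes "s > 0" and "S \<in> sets borel"
  shows "set_integrable lborel S (\<lambda>z. std_normal_density (z / s))"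
proof -
  have "integrable lborel (\<lambda>z. std_normal_density (0 + (1 / s) * z))"
    using assms(1) by (intro lborel_integrable_real_affine integrable_std_normal_density) auto
  from integrable_real_mult_indicator[OF _ this, of S] assms(2) show ?thesis
    by (simp add: set_integrable_def mult.commute)
qed

text \<open>Substituting \<open>- s * z\<close> sends the upper tail to a lower one, and the density
  is even.\<close>

lemma LINT_scaled_std_normal_tail:
  assumes "s > 0"
  shows "(LINT z:{A..}|lborel. std_normal_density (z / s)) = s * std_normal_cdf (- A / s)"
proof -
  have "(LINT z:{A..}|lborel. std_normal_density (z / s)) =
      \<bar>- s\<bar> *\<^sub>R (LINT z|lborel. indicator {A..} (0 + (- s) * z) *\<^sub>R
        std_normal_density ((0 + (- s) * z) / s))"
    unfolding set_lebesgue_integral_def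
    using assms by (intro lborel_integral_real_affine) auto
  also have "(LINT z|lborel. indicator {A..} (0 + (- s) * z) *\<^sub>R
        std_normal_density ((0 + (- s) * z) / s)) = std_normal_cdf (- A / s)"
    unfolding std_normal_cdf_eq_LINT set_lebesgue_integral_def
    using assms
    by (intro Bochner_Integration.integral_cong)
      (auto simp: indicator_def std_normal_density_minus field_simps)
  finally show ?thesis using assms by simp
qed

section \<open>The self-similar profile\<close>

lemma f_profile_eq:
  assumes "0 < a" and "0 < b"
  shows "f_profile a b y = 2 / (b + a) *
    (if y \<le> 0 then b * std_normal_cdf (y / b) else a * std_normal_cdf (y / a) + (b - a) / 2)"
proof (cases "y \<le> 0")
  case True
  have "(LINT z:{- y..}|lborel. std_normal_density (z / b) * of_bool (z \<ge> 0) +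
      std_normal_density (z / a) * of_bool (z < 0)) =
      (LINT z:{- y..}|lborel. std_normal_density (z / b))"
    using True by (intro set_lebesgue_integral_cong) auto
  then show ?thesis
    using True assms by (simp add: f_profile_def LINT_scaled_std_normal_tail)
next
  case False
  \<comment> \<open>The range now contains 0. Instead of splitting it, the density with volatility
    \<open>a\<close> is integrated over the whole range and exchanged for the one with volatility
    \<open>b\<close> on the nonnegative half-line, where the two integrals are \<open>a / 2\<close>
    and \<open>b / 2\<close>.\<close>
  have "(LINT z:{- y..}|lborel. std_normal_density (z / b) * of_bool (z \<ge> 0) +
      std_normal_density (z / a) * of_bool (z < 0)) =
      (LINT z|lborel. indicator {- y..} z *\<^sub>R std_normal_density (z / a) +
        (indicator {0..} z *\<^sub>R std_normal_density (z / b) -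
         indicator {0..} z *\<^sub>R std_normal_density (z / a)))"
    unfolding set_lebesgue_integral_def
    using False by (intro Bochner_Integration.integral_cong) (auto simp: indicator_def)
  also have "\<dots> = (LINT z:{- y..}|lborel. std_normal_density (z / a)) +
      ((LINT z:{0..}|lborel. std_normal_density (z / b)) -
       (LINT z:{0..}|lborel. std_normal_density (z / a)))"
  proof -
    have int: "integrable lborel (\<lambda>z. indicator {A..} z *\<^sub>R std_normal_density (z / s))"
      if "s > 0" for A s :: real
      using set_integrable_scaled_std_normal_density[OF that] by (simp add: set_integrable_def)
    show ?thesis
      unfolding set_lebesgue_integral_def
      by (simp only: Bochner_Integration.integral_add Bochner_Integration.integral_diff
          Bochner_Integration.integrable_diff int assms)
  qed
  also have "\<dots> = a * std_normal_cdf (y / a) + (b - a) / 2"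
    using assms by (simp add: LINT_scaled_std_normal_tail std_normal_cdf_0 field_simps)
  finally show ?thesis
    using False by (simp add: f_profile_def)
qed

definition f_profile' :: "real \<Rightarrow> real \<Rightarrow> real \<Rightarrow> real" where
  "f_profile' a b y = 2 / (b + a) * std_normal_density (y / (if y \<le> 0 then b else a))"

text \<open>The factor \<open>y\<close> vanishes where the volatility switches, so this function is
  continuous at 0 and the profile is of class C^2 in spite of its two branches.\<close>

definition f_profile'' :: "real \<Rightarrow> real \<Rightarrow> real \<Rightarrow> real" where
  "f_profile'' a b y = - y / (if y \<le> 0 then b else a)\<^sup>2 * f_profile' a b y"

text \<open>At the junction each one-sided difference quotient is that of one piece, and the two
  limits agree. This glues the Gaussian branches of the profile, and later the time penalty to
  zero.\<close>

lemma DERIV_If_le: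
  fixes g h :: "real \<Rightarrow> real"
  assumes g: "\<And>y. y \<le> p \<Longrightarrow> (g has_real_derivative g' y) (at y)"
    and h: "\<And>y. y \<ge> p \<Longrightarrow> (h has_real_derivative h' y) (at y)"
    and "g p = h p" and "g' p = h' p"
  shows "((\<lambda>y. if y \<le> p then g y else h y) has_real_derivative
    (if y \<le> p then g' y else h' y)) (at y)"
proof -
  let ?k = "\<lambda>y. if y \<le> p then g y else h y"
  consider "y < p" | "y > p" | "y = p" by linarith
  then show ?thesis
  proof cases
    case 1
    then have "(?k has_real_derivative g' y) (at y)"
      by (intro has_field_derivative_transform_within_open[OF g, of y "{..<p}"]) auto
    with 1 show ?thesis by simp
  next
    case 2
    then have "(?k has_real_derivative h' y) (at y)"
      by (intro has_field_derivative_transform_within_open[OF h, of y "{p<..}"]) auto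
    with 2 show ?thesis by simp
  next
    case 3
    have "((\<lambda>z. (?k z - ?k p) / (z - p)) \<longlongrightarrow> g' p) (at p)"
    proof (rule filterlim_split_at)
      have "((\<lambda>z. (g z - g p) / (z - p)) \<longlongrightarrow> g' p) (at_left p)"
        using g[of p] by (auto simp: has_field_derivative_iff intro: filterlim_mono at_le)
      then show "((\<lambda>z. (?k z - ?k p) / (z - p)) \<longlongrightarrow> g' p) (at_left p)"
        by (rule Lim_transform_eventually) (auto simp: eventually_at_filter)
      have "((\<lambda>z. (h z - h p) / (z - p)) \<longlongrightarrow> h' p) (at_right p)"
        using h[of p] by (auto simp: has_field_derivative_iff intro: filterlim_mono at_le)
      then show "((\<lambda>z. (?k z - ?k p) / (z - p)) \<longlongrightarrow> g' p) (at_right p)"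
        unfolding assms(4)
        by (rule Lim_transform_eventually) (auto simp: eventually_at_filter assms(3))
    qed
    with 3 show ?thesis by (simp add: has_field_derivative_iff)
  qed
qed

lemma DERIV_f_profile:
  assumes "0 < a" and "0 < b"
  shows "(f_profile a b has_real_derivative f_profile' a b y) (at y)"
proof -
  define k where "k = 2 / (b + a)"
  have "((\<lambda>y. if y \<le> 0 then k * (b * std_normal_cdf (y / b))
        else k * (a * std_normal_cdf (y / a) + (b - a) / 2)) has_real_derivative
      (if y \<le> 0 then k * std_normal_density (y / b)
        else k * std_normal_density (y / a))) (at y)"
  proof (rule DERIV_If_le)
    have *: "((\<lambda>z. std_normal_cdf (z / s)) has_real_derivative std_normal_density (y / s) * (1 / s)) (at y)"
      for s y
      by (rule DERIV_chain2[OF DERIV_std_normal_cdf DERIV_cdivide[OF DERIV_ident]])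
    show "((\<lambda>z. k * (b * std_normal_cdf (z / b))) has_real_derivative
        k * std_normal_density (y / b)) (at y)" for y
      using DERIV_cmult[OF DERIV_cmult[OF *[of b y]], of k b] assms by simp
    show "((\<lambda>z. k * (a * std_normal_cdf (z / a) + (b - a) / 2)) has_real_derivative
        k * std_normal_density (y / a)) (at y)" for y
      using DERIV_cmult[OF DERIV_add[OF DERIV_cmult[OF *[of a y]] DERIV_const], of k a] assms
      by simp
  qed (simp_all add: std_normal_cdf_0 field_simps)
  moreover have "f_profile a b = (\<lambda>y. if y \<le> 0 then k * (b * std_normal_cdf (y / b))
        else k * (a * std_normal_cdf (y / a) + (b - a) / 2))"
    using assms by (auto simp: f_profile_eq k_def)
  ultimately show ?thesis
    by (simp add: f_profile'_def k_def if_distrib cong: if_cong)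
qed

lemma DERIV_f_profile':
  assumes "0 < a" and "0 < b"
  shows "(f_profile' a b has_real_derivative f_profile'' a b y) (at y)"
proof -
  define k where "k = 2 / (b + a)"
  have "((\<lambda>y. if y \<le> 0 then k * std_normal_density (y / b)
        else k * std_normal_density (y / a)) has_real_derivative
      (if y \<le> 0 then - y / b\<^sup>2 * (k * std_normal_density (y / b))
        else - y / a\<^sup>2 * (k * std_normal_density (y / a)))) (at y)"
  proof (rule DERIV_If_le)
    have *: "((\<lambda>z. k * std_normal_density (z / s)) has_real_derivative
        - y / s\<^sup>2 * (k * std_normal_density (y / s))) (at y)" for s y
      using DERIV_cmult[OF DERIV_chain2[OF DERIV_std_normal_density DERIV_cdivide[OF DERIV_ident]], of k s y]
      by (simp add: power2_eq_square mult_ac)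
    show "((\<lambda>z. k * std_normal_density (z / b)) has_real_derivative
        - y / b\<^sup>2 * (k * std_normal_density (y / b))) (at y)" for y
      by (rule *)
    show "((\<lambda>z. k * std_normal_density (z / a)) has_real_derivative
        - y / a\<^sup>2 * (k * std_normal_density (y / a))) (at y)" for y
      by (rule *)
  qed simp_all
  moreover have "f_profile' a b = (\<lambda>y. if y \<le> 0 then k * std_normal_density (y / b)
        else k * std_normal_density (y / a))"
    by (auto simp: f_profile'_def k_def)
  ultimately show ?thesis
    by (simp add: f_profile''_def k_def f_profile'_def if_distrib cong: if_cong)
qed

lemma continuous_on_f_profile:
  assumes "0 < a" and "0 < b"
  shows "continuous_on UNIV (f_profile a b)" and "continuous_on UNIV (f_profile' a b)"
  using DERIV_f_profile[OF assms] DERIV_f_profile'[OF assms]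
  by (blast intro: DERIV_continuous_on has_field_derivative_at_within)+

lemma continuous_on_f_profile'':
  assumes "0 < a" and "0 < b"
  shows "continuous_on UNIV (f_profile'' a b)"
proof -
  have "continuous_on ({..0} \<union> {0..}) (\<lambda>y. if y \<le> 0
      then - y / b\<^sup>2 * (2 / (b + a) * std_normal_density (y / b))
      else - y / a\<^sup>2 * (2 / (b + a) * std_normal_density (y / a)))"
    using assms by (intro continuous_on_If) (auto intro!: continuous_intros)
  moreover have "({..0} \<union> {0..} :: real set) = UNIV" by auto
  moreover have "f_profile'' a b = (\<lambda>y. if y \<le> 0
      then - y / b\<^sup>2 * (2 / (b + a) * std_normal_density (y / b))
      else - y / a\<^sup>2 * (2 / (b + a) * std_normal_density (y / a)))"
    by (auto simp: f_profile''_def f_profile'_def)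
  ultimately show ?thesis by simp
qed

lemma f_profile_at_bot:
  assumes "0 < a" and "0 < b"
  shows "(f_profile a b \<longlongrightarrow> 0) at_bot"
proof -
  have "((\<lambda>y. 2 / (b + a) * (b * std_normal_cdf ((1 / b) * y))) \<longlongrightarrow> 2 / (b + a) * (b * 0)) at_bot"
    using assms
    by (intro tendsto_intros filterlim_compose[OF std_normal_cdf_at_bot]
        filterlim_tendsto_pos_mult_at_bot[OF tendsto_const] filterlim_ident) auto
  then have "((\<lambda>y. 2 / (b + a) * (b * std_normal_cdf ((1 / b) * y))) \<longlongrightarrow> 0) at_bot"
    by simp
  moreover have "\<forall>\<^sub>F y in at_bot. 2 / (b + a) * (b * std_normal_cdf ((1 / b) * y)) = f_profile a b y"
    using eventually_le_at_bot[of 0] by eventually_elim (simp add: f_profile_eq assms)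
  ultimately show ?thesis
    by (rule Lim_transform_eventually)
qed

lemma f_profile_at_top:
  assumes "0 < a" and "0 < b"
  shows "(f_profile a b \<longlongrightarrow> 1) at_top"
proof -
  have "((\<lambda>y. 2 / (b + a) * (a * std_normal_cdf ((1 / a) * y) + (b - a) / 2)) \<longlongrightarrow>
      2 / (b + a) * (a * 1 + (b - a) / 2)) at_top"
    using assms
    by (intro tendsto_intros filterlim_compose[OF std_normal_cdf_at_top]
        filterlim_tendsto_pos_mult_at_top[OF tendsto_const] filterlim_ident) auto
  also have "2 / (b + a) * (a * 1 + (b - a) / 2) = 1"
    using assms by (simp add: field_simps)
  finally have "((\<lambda>y. 2 / (b + a) * (a * std_normal_cdf ((1 / a) * y) + (b - a) / 2)) \<longlongrightarrow> 1) at_top" .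
  moreover have "\<forall>\<^sub>F y in at_top.
      2 / (b + a) * (a * std_normal_cdf ((1 / a) * y) + (b - a) / 2) = f_profile a b y"
    using eventually_gt_at_top[of 0] by eventually_elim (simp add: f_profile_eq assms)
  ultimately show ?thesis
    by (rule Lim_transform_eventually)
qed

section \<open>Test functions and the nonlinearity\<close>

lemma C12_on_halfspace_add:
  assumes "C12_on_halfspace \<psi> p q r" and "C12_on_halfspace \<psi>' p' q' r'"
  shows "C12_on_halfspace (\<lambda>t x. \<psi> t x + \<psi>' t x) (\<lambda>t x. p t x + p' t x)
    (\<lambda>t x. q t x + q' t x) (\<lambda>t x. r t x + r' t x)"
  using assms unfolding C12_on_halfspace_def split_def
  by (auto intro!: DERIV_add continuous_on_add)

lemma C12_on_halfspace_cmult: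
  assumes "C12_on_halfspace \<psi> p q r"
  shows "C12_on_halfspace (\<lambda>t x. k * \<psi> t x) (\<lambda>t x. k * p t x)
    (\<lambda>t x. k * q t x) (\<lambda>t x. k * r t x)"
  using assms unfolding C12_on_halfspace_def split_def
  by (auto intro!: DERIV_cmult continuous_on_mult_left)

lemma C12_on_halfspace_time:
  assumes "\<And>t. t > 0 \<Longrightarrow> (\<eta> has_real_derivative \<eta>' t) (at t)" and "continuous_on {0<..} \<eta>'"
  shows "C12_on_halfspace (\<lambda>t x. \<eta> t) (\<lambda>t x. \<eta>' t) (\<lambda>t x. 0) (\<lambda>t x. 0)"
proof -
  have "continuous_on {0<..} \<eta>"
    by (rule DERIV_continuous_on[OF has_field_derivative_at_within[OF assms(1)]]) simp
  moreover have "continuous_on ({0<..} \<times> UNIV) (\<lambda>z::real \<times> real. g (fst z))"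
    if "continuous_on {0<..} g" for g :: "real \<Rightarrow> real"
    by (rule continuous_on_compose2[OF that continuous_on_fst[OF continuous_on_id]]) auto
  ultimately show ?thesis
    using assms by (auto simp: C12_on_halfspace_def split_def)
qed

text \<open>Supplies the translate and the reflected translate of a single self-similar wave, as
  well as the barriers centred at \<open>c\<close> and \<open>- c\<close>.\<close>

lemma C12_on_halfspace_affine:
  assumes "C12_on_halfspace \<psi> p q r"
  shows "C12_on_halfspace (\<lambda>t x. \<psi> t (e * x + d)) (\<lambda>t x. p t (e * x + d))
    (\<lambda>t x. e * q t (e * x + d)) (\<lambda>t x. e\<^sup>2 * r t (e * x + d))"
proof -
  have chain: "((\<lambda>y. g (e * y + d)) has_real_derivative e * g') (at x)"
    if "(g has_real_derivative g') (at (e * x + d))" for g g' x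
  proof -
    have "((\<lambda>y. e * y + d) has_real_derivative e) (at x)"
      by (auto intro!: derivative_eq_intros)
    from DERIV_chain2[of g, OF that this] show ?thesis
      by (simp add: mult.commute)
  qed
  have cont: "continuous_on ({0<..} \<times> UNIV) (\<lambda>z. g (fst z) (e * snd z + d))"
    if "continuous_on ({0<..} \<times> UNIV) (\<lambda>z. g (fst z) (snd z))" for g :: "real \<Rightarrow> real \<Rightarrow> real"
  proof -
    have "continuous_on ({0<..} \<times> UNIV) (\<lambda>z::real \<times> real. (fst z, e * snd z + d))"
      by (intro continuous_intros)
    from continuous_on_compose2[OF that this] show ?thesis
      by fastforce
  qed
  show ?thesis
    using assms unfolding C12_on_halfspace_def split_def
    by (auto intro!: chain cont continuous_on_mult_left DERIV_cmult simp: power2_eq_square mult.assoc)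
qed

text \<open>\<open>G_fun a b A\<close> is the maximum of \<open>s / 2 * A\<close> over all variances
  \<open>s\<close> between \<open>a\<^sup>2\<close> and \<open>b\<^sup>2\<close>. The two equations
  that follow say at which endpoint it is attained.\<close>

lemma G_fun_ge:
  assumes "a\<^sup>2 \<le> s" and "s \<le> b\<^sup>2"
  shows "s / 2 * A \<le> G_fun a b A"
proof (cases "A \<ge> 0")
  case True
  then show ?thesis using mult_right_mono[OF assms(2), of A] by (simp add: G_fun_def)
next
  case False
  then have "s * A \<le> a\<^sup>2 * A" using assms(1) by (intro mult_right_mono_neg) auto
  with False show ?thesis by (simp add: G_fun_def)
qed

lemma G_fun_nonneg_eq: "A \<ge> 0 \<Longrightarrow> G_fun a b A = b\<^sup>2 / 2 * A"
  by (simp add: G_fun_def)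

lemma G_fun_nonpos_eq: "A \<le> 0 \<Longrightarrow> G_fun a b A = a\<^sup>2 / 2 * A"
  by (simp add: G_fun_def)

text \<open>The value at \<open>A + B\<close> is attained at one endpoint variance, and
  \<open>G_fun_ge\<close> with this same variance bounds each summand.\<close>

lemma G_fun_add_le:
  assumes "a\<^sup>2 \<le> b\<^sup>2"
  shows "G_fun a b (A + B) \<le> G_fun a b A + G_fun a b B"
  using G_fun_ge[of a "a\<^sup>2" b A] G_fun_ge[of a "a\<^sup>2" b B] G_fun_ge[of a "b\<^sup>2" b A]
    G_fun_ge[of a "b\<^sup>2" b B] assms
  by (cases "A + B \<ge> 0") (auto simp: G_fun_nonneg_eq G_fun_nonpos_eq distrib_left)

lemma G_fun_cmult: "k \<ge> 0 \<Longrightarrow> G_fun a b (k * A) = k * G_fun a b A"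
  by (cases "A \<ge> 0")
    (auto simp: G_fun_nonneg_eq G_fun_nonpos_eq mult_nonneg_nonpos)

section \<open>Self-similar solutions\<close>

text \<open>The wave issuing from the indicator of the positive half-line. At positive times
  \<open>u\<close> and \<open>v\<close> are its values at \<open>x - c\<close> and
  \<open>- x - c\<close>.\<close>

definition selfsimilar :: "real \<Rightarrow> real \<Rightarrow> real \<Rightarrow> real \<Rightarrow> real" where
  "selfsimilar a b t x = f_profile a b (x / sqrt t)"

definition selfsimilar_t :: "real \<Rightarrow> real \<Rightarrow> real \<Rightarrow> real \<Rightarrow> real" where
  "selfsimilar_t a b t x = - (x / sqrt t) / (2 * t) * f_profile' a b (x / sqrt t)"

definition selfsimilar_x :: "real \<Rightarrow> real \<Rightarrow> real \<Rightarrow> real \<Rightarrow> real" where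
  "selfsimilar_x a b t x = f_profile' a b (x / sqrt t) / sqrt t"

definition selfsimilar_xx :: "real \<Rightarrow> real \<Rightarrow> real \<Rightarrow> real \<Rightarrow> real" where
  "selfsimilar_xx a b t x = f_profile'' a b (x / sqrt t) / t"

lemma C12_selfsimilar:
  assumes "0 < a" and "0 < b"
  shows "C12_on_halfspace (selfsimilar a b) (selfsimilar_t a b) (selfsimilar_x a b) (selfsimilar_xx a b)"
proof -
  have cont: "continuous_on ({0<..} \<times> UNIV) (\<lambda>z. g (snd z / sqrt (fst z)))"
    if "continuous_on UNIV g" for g :: "real \<Rightarrow> real"
  proof (rule continuous_on_compose2[OF that])
    show "continuous_on ({0<..} \<times> UNIV) (\<lambda>z::real \<times> real. snd z / sqrt (fst z))"
      by (intro continuous_on_divide continuous_on_snd continuous_on_fst continuous_on_real_sqrt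
          continuous_on_id) auto
  qed simp
  have fst: "continuous_on ({0<..} \<times> UNIV) (\<lambda>z::real \<times> real. fst z)"
    and sqrt: "continuous_on ({0<..} \<times> UNIV) (\<lambda>z::real \<times> real. sqrt (fst z))"
    by (intro continuous_on_fst continuous_on_real_sqrt continuous_on_id)+
  note c0 = cont[OF continuous_on_id]
    and c1 = cont[OF continuous_on_f_profile(2)[OF assms]]
    and c2 = cont[OF continuous_on_f_profile''[OF assms]]
  show ?thesis
    unfolding C12_on_halfspace_def
  proof (intro conjI allI impI)
    fix t x :: real assume "t > 0"
    have "((\<lambda>s. x / sqrt s) has_real_derivative - (x / sqrt t) / (2 * t)) (at t)"
      using \<open>t > 0\<close>
      by (auto intro!: derivative_eq_intros simp: field_simps)
    from DERIV_chain2[OF DERIV_f_profile[OF assms] this]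
    show "((\<lambda>s. selfsimilar a b s x) has_real_derivative selfsimilar_t a b t x) (at t)"
      by (simp add: selfsimilar_def selfsimilar_t_def mult.commute)
    have *: "((\<lambda>y. y / sqrt t) has_real_derivative 1 / sqrt t) (at x)"
      by (rule DERIV_cdivide[OF DERIV_ident])
    from DERIV_chain2[OF DERIV_f_profile[OF assms] this]
    show "((\<lambda>y. selfsimilar a b t y) has_real_derivative selfsimilar_x a b t x) (at x)"
      by (simp add: selfsimilar_def selfsimilar_x_def)
    from DERIV_cdivide[OF DERIV_chain2[OF DERIV_f_profile'[OF assms] *], of "sqrt t"] \<open>t > 0\<close>
    show "((\<lambda>y. selfsimilar_x a b t y) has_real_derivative selfsimilar_xx a b t x) (at x)"
      by (simp add: selfsimilar_xx_def selfsimilar_x_def)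
  next
    show "continuous_on ({0<..} \<times> UNIV) (\<lambda>(t, x). selfsimilar a b t x)"
      unfolding selfsimilar_def split_def by (rule cont[OF continuous_on_f_profile(1)[OF assms]])
    show "continuous_on ({0<..} \<times> UNIV) (\<lambda>(t, x). selfsimilar_t a b t x)"
      unfolding selfsimilar_t_def split_def
      by (intro continuous_on_mult continuous_on_divide continuous_on_minus continuous_on_const
          c0 c1 fst) auto
    show "continuous_on ({0<..} \<times> UNIV) (\<lambda>(t, x). selfsimilar_x a b t x)"
      unfolding selfsimilar_x_def split_def
      by (intro continuous_on_divide c1 sqrt) auto
    show "continuous_on ({0<..} \<times> UNIV) (\<lambda>(t, x). selfsimilar_xx a b t x)"
      unfolding selfsimilar_xx_def split_def
      by (intro continuous_on_divide c2 fst) auto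
  qed
qed

text \<open>The wave is convex to the left of 0 and concave to the right. The sign selects the
  volatility that is active in \<open>G_fun\<close>.\<close>

lemma selfsimilar_xx_sign:
  assumes "0 < a" and "0 < b" and "t > 0"
  shows "x \<le> 0 \<Longrightarrow> selfsimilar_xx a b t x \<ge> 0" and "x \<ge> 0 \<Longrightarrow> selfsimilar_xx a b t x \<le> 0"
  using assms
  by (auto simp: selfsimilar_xx_def f_profile''_def f_profile'_def divide_nonpos_pos
      intro!: divide_nonneg_nonneg divide_nonpos_nonneg mult_nonneg_nonneg mult_nonpos_nonneg)

text \<open>On each side of 0 the equation is the linear heat equation with variance
  \<open>b\<^sup>2\<close> or \<open>a\<^sup>2\<close>, and the profile uses exactly this variance
  on that side.\<close>

lemma selfsimilar_gheat:
  assumes "0 < a" and "0 < b" and "t > 0"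
  shows "selfsimilar_t a b t x = G_fun a b (selfsimilar_xx a b t x)"
proof (cases "x \<le> 0")
  case True
  with assms selfsimilar_xx_sign(1)[OF assms True] show ?thesis
    by (simp add: G_fun_nonneg_eq selfsimilar_t_def selfsimilar_xx_def f_profile''_def
        divide_le_0_iff field_simps)
next
  case False
  with assms selfsimilar_xx_sign(2)[OF assms, of x] show ?thesis
    by (simp add: G_fun_nonpos_eq selfsimilar_t_def selfsimilar_xx_def f_profile''_def
        divide_le_0_iff field_simps)
qed

section \<open>Comparison with classical semisolutions\<close>

text \<open>The logarithm alone is not a supersolution away from \<open>x = 0\<close>, where it is convex; the second
  term, bounded and homogeneous of degree 0 under parabolic scaling, compensates for this.\<close>

definition log_barrier :: "real \<Rightarrow> real \<Rightarrow> real \<Rightarrow> real \<Rightarrow> real" where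
  "log_barrier K m t x = - ln (x\<^sup>2 + K * t) + m * t / (x\<^sup>2 + K * t)"

definition log_barrier_t :: "real \<Rightarrow> real \<Rightarrow> real \<Rightarrow> real \<Rightarrow> real" where
  "log_barrier_t K m t x = (m - K) / (x\<^sup>2 + K * t) - m * K * t / (x\<^sup>2 + K * t)\<^sup>2"

definition log_barrier_x :: "real \<Rightarrow> real \<Rightarrow> real \<Rightarrow> real \<Rightarrow> real" where
  "log_barrier_x K m t x = - 2 * x / (x\<^sup>2 + K * t) - 2 * m * t * x / (x\<^sup>2 + K * t)\<^sup>2"

definition log_barrier_xx :: "real \<Rightarrow> real \<Rightarrow> real \<Rightarrow> real \<Rightarrow> real" where
  "log_barrier_xx K m t x = - 2 / (x\<^sup>2 + K * t) + (4 * x\<^sup>2 - 2 * m * t) / (x\<^sup>2 + K * t)\<^sup>2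
    + 8 * m * t * x\<^sup>2 / (x\<^sup>2 + K * t) ^ 3"

lemma C12_log_barrier:
  assumes "K > 0"
  shows "C12_on_halfspace (log_barrier K m) (log_barrier_t K m) (log_barrier_x K m) (log_barrier_xx K m)"
proof -
  have pos: "x\<^sup>2 + K * t > 0" if "t > 0" for t x
    using that assms by (intro add_nonneg_pos) auto
  then have nz: "x\<^sup>2 + K * t \<noteq> 0" if "t > 0" for t x
    using pos[OF that, of x] by simp
  show ?thesis
    unfolding C12_on_halfspace_def
  proof (intro conjI allI impI)
    fix t x :: real assume t: "t > 0"
    define R where "R = x\<^sup>2 + K * t"
    have R: "R > 0" and Kt: "K * t = R - x\<^sup>2"
      using pos[OF t] by (auto simp: R_def)
    have dt: "((\<lambda>s. x\<^sup>2 + K * s) has_real_derivative K) (at t)"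
      by (auto intro!: derivative_eq_intros)
    have "((\<lambda>s. log_barrier K m s x) has_real_derivative
        - (K / R) + (m * R - m * t * K) / (R * R)) (at t)"
      unfolding log_barrier_def R_def using pos[OF t, of x]
      by (auto intro!: derivative_eq_intros dt)
    also have "- (K / R) + (m * R - m * t * K) / (R * R) = log_barrier_t K m t x"
      unfolding log_barrier_t_def R_def[symmetric] using R by (simp add: field_simps power2_eq_square)
    finally show "((\<lambda>s. log_barrier K m s x) has_real_derivative log_barrier_t K m t x) (at t)" .
    have dx: "((\<lambda>y. y\<^sup>2 + K * t) has_real_derivative 2 * x) (at x)"
      by (auto intro!: derivative_eq_intros)
    have "((\<lambda>y. log_barrier K m t y) has_real_derivative
        - (2 * x / R) + (- (m * t * (2 * x))) / (R * R)) (at x)"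
      unfolding log_barrier_def R_def using pos[OF t, of x]
      by (auto intro!: derivative_eq_intros dx)
    also have "- (2 * x / R) + (- (m * t * (2 * x))) / (R * R) = log_barrier_x K m t x"
      unfolding log_barrier_x_def R_def[symmetric] using R by (simp add: field_simps power2_eq_square)
    finally show "((\<lambda>y. log_barrier K m t y) has_real_derivative log_barrier_x K m t x) (at x)" .
    have "((\<lambda>y. log_barrier_x K m t y) has_real_derivative
        ((- 2) * R - (- 2 * x) * (2 * x)) / (R * R) -
        ((2 * m * t) * R\<^sup>2 - (2 * m * t * x) * (2 * R * (2 * x))) / (R\<^sup>2 * R\<^sup>2)) (at x)"
    proof -
      have n1: "((\<lambda>y. - 2 * y) has_real_derivative - 2) (at x)"
        and n2: "((\<lambda>y. 2 * m * t * y) has_real_derivative 2 * m * t) (at x)"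
        by (auto intro!: derivative_eq_intros)
      have dx2: "((\<lambda>y. (y\<^sup>2 + K * t)\<^sup>2) has_real_derivative 2 * R * (2 * x)) (at x)"
        unfolding R_def by (auto intro!: derivative_eq_intros dx)
      show ?thesis
        using DERIV_diff[OF DERIV_divide[OF n1 dx] DERIV_divide[OF n2 dx2]] R
        by (simp add: log_barrier_x_def[abs_def] R_def)
    qed
    also have "((- 2) * R - (- 2 * x) * (2 * x)) / (R * R) -
        ((2 * m * t) * R\<^sup>2 - (2 * m * t * x) * (2 * R * (2 * x))) / (R\<^sup>2 * R\<^sup>2) =
        log_barrier_xx K m t x"
      unfolding log_barrier_xx_def R_def[symmetric] using R by (simp add: field_simps power2_eq_square
          power3_eq_cube)
    finally show "((\<lambda>y. log_barrier_x K m t y) has_real_derivative log_barrier_xx K m t x) (at x)" .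
  next
    show "continuous_on ({0<..} \<times> UNIV) (\<lambda>(t, x). log_barrier K m t x)"
      unfolding log_barrier_def split_def using nz by (intro continuous_intros) auto
    show "continuous_on ({0<..} \<times> UNIV) (\<lambda>(t, x). log_barrier_t K m t x)"
      unfolding log_barrier_t_def split_def using nz by (intro continuous_intros) auto
    show "continuous_on ({0<..} \<times> UNIV) (\<lambda>(t, x). log_barrier_x K m t x)"
      unfolding log_barrier_x_def split_def using nz by (intro continuous_intros) auto
    show "continuous_on ({0<..} \<times> UNIV) (\<lambda>(t, x). log_barrier_xx K m t x)"
      unfolding log_barrier_xx_def split_def using nz by (intro continuous_intros) auto
  qed
qed

text \<open>By the maximum formula for \<open>G_fun\<close> only linear operators with variance
  \<open>s\<close> have to be treated. In terms of \<open>\<theta> = x\<^sup>2 / R\<close> both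
  sides are polynomials in \<open>\<theta>\<close> divided by \<open>R\<close>, so the claim is a
  polynomial inequality for \<open>\<theta>\<close> between 0 and 1.\<close>

lemma log_barrier_supersolution:
  assumes "0 < a" and "a \<le> b" and "t > 0"
    and K: "K = 5 * b\<^sup>2" and m: "m = 30 * b ^ 4 / a\<^sup>2"
  shows "G_fun a b (log_barrier_xx K m t x) \<le> log_barrier_t K m t x"
proof -
  define R where "R = x\<^sup>2 + K * t"
  define \<theta> where "\<theta> = x\<^sup>2 / R"
  have "b > 0" using assms by simp
  then have "K > 0" by (simp add: K)
  then have R: "R > 0"
    using assms(3) unfolding R_def by (intro add_nonneg_pos) auto
  have \<theta>: "0 \<le> \<theta>" "\<theta> \<le> 1"
    using R \<open>K > 0\<close> \<open>t > 0\<close> by (auto simp: \<theta>_def R_def divide_simps)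
  have x2: "x\<^sup>2 = \<theta> * R"
    using R by (simp add: \<theta>_def)
  then have "K * t = (1 - \<theta>) * R"
    by (simp add: R_def algebra_simps)
  then have Kt: "t = (1 - \<theta>) * R / K"
    using \<open>K > 0\<close> by (simp add: field_simps)
  have bt: "log_barrier_t K m t x = (m * \<theta> - K) / R"
    unfolding log_barrier_t_def R_def[symmetric] unfolding Kt using R \<open>K > 0\<close>
    by (simp add: field_simps power2_eq_square)
  have bxx: "log_barrier_xx K m t x = (- 2 + 4 * \<theta> + 2 * m / K * ((1 - \<theta>) * (4 * \<theta> - 1))) / R"
    unfolding log_barrier_xx_def R_def[symmetric] unfolding x2 Kt using R \<open>K > 0\<close>
    by (simp add: field_simps power2_eq_square power3_eq_cube)
  have main: "s / 2 * log_barrier_xx K m t x \<le> log_barrier_t K m t x"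
    if s: "a\<^sup>2 \<le> s" "s \<le> b\<^sup>2" for s
  proof -
    define r where "r = s / K"
    have r: "a\<^sup>2 / K \<le> r" "r \<le> 1 / 5" "r \<ge> 0"
      using s \<open>K > 0\<close> \<open>b > 0\<close> order_trans[OF zero_le_power2 s(1)]
      by (auto simp: r_def divide_right_mono K divide_simps)
    have "m \<ge> 0" using m by simp
    \<comment> \<open>The right side is
      \<open>\<theta> - r * ((1 - \<theta>) * (4 * \<theta> - 1))\<close> expanded. The 5 in
      \<open>K\<close> gives \<open>r \<le> 1 / 5\<close>, which makes the coefficient
      \<open>1 - 5 * r\<close> nonnegative.\<close>
    have "r \<le> r + \<theta> * (1 - 5 * r) + 4 * r * \<theta>\<^sup>2"
      using r \<theta> by simp
    then have "m * (a\<^sup>2 / K) \<le> m * (r + \<theta> * (1 - 5 * r) + 4 * r * \<theta>\<^sup>2)"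
      using r(1) \<open>m \<ge> 0\<close> by (intro mult_left_mono) auto
    \<comment> \<open>The constant 30 in \<open>m\<close> is chosen for this identity: the terms
      with \<open>m\<close> pay for \<open>K\<close> and for the remaining term, which is at most
      \<open>b\<^sup>2\<close>.\<close>
    moreover have "m * (a\<^sup>2 / K) = K + b\<^sup>2"
      using \<open>0 < a\<close> \<open>b > 0\<close> by (simp add: m K field_simps power2_eq_square power4_eq_xxxx)
    moreover have "s * (2 * \<theta> - 1) \<le> b\<^sup>2 * 1"
      using s \<theta> order_trans[OF zero_le_power2 s(1)] mult_left_mono[of "2 * \<theta> - 1" 1 s] by auto
    ultimately have "s * (2 * \<theta> - 1) + m * r * ((1 - \<theta>) * (4 * \<theta> - 1)) \<le> m * \<theta> - K"
      by (simp add: algebra_simps power2_eq_square)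
    then have "(s * (2 * \<theta> - 1) + m * r * ((1 - \<theta>) * (4 * \<theta> - 1))) / R \<le> (m * \<theta> - K) / R"
      using R by (intro divide_right_mono) auto
    also have "(s * (2 * \<theta> - 1) + m * r * ((1 - \<theta>) * (4 * \<theta> - 1))) / R =
        s / 2 * log_barrier_xx K m t x"
      unfolding bxx r_def using R \<open>K > 0\<close> by (simp add: field_simps)
    finally show ?thesis
      by (simp add: bt)
  qed
  have "a\<^sup>2 \<le> b\<^sup>2"
    using assms by (intro power_mono) auto
  with main[of "a\<^sup>2"] main[of "b\<^sup>2"] show ?thesis
    by (cases "log_barrier_xx K m t x \<ge> 0") (auto simp: G_fun_nonneg_eq G_fun_nonpos_eq)
qed

section \<open>Maxima of penalized differences and the two comparison principles\<close>

text \<open>The time penalty, which vanishes up to \<open>t\<close>, keeps the maximum away from the terminal time \<open>T\<close>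
  and leaves the test function smooth on the whole half-space.\<close>

lemma penalized_maximum:
  fixes D P :: "real \<Rightarrow> real \<Rightarrow> real"
  assumes t: "0 < t" "t < T" and "\<delta> > 0"
    and contD: "continuous_on ({0<..} \<times> UNIV) (\<lambda>(s, y). D s y)"
    and contP: "continuous_on ({0<..} \<times> UNIV) (\<lambda>(s, y). P s y)"
    and D_le: "\<And>s y. 0 < s \<Longrightarrow> s \<le> T \<Longrightarrow> D s y \<le> M"
    and P_ge: "\<And>s y. 0 < s \<Longrightarrow> s \<le> T \<Longrightarrow> y\<^sup>2 \<le> P s y"
    and initial: "\<And>y \<theta>. \<theta> > 0 \<Longrightarrow>
      \<forall>\<^sub>F (s, z) in at (0, y) within {0<..} \<times> UNIV. D s z - \<delta> * P s z < \<theta>"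
    and pos: "D t x > \<delta> * P t x"
  obtains N s y where "N \<ge> 0" "0 < s" "s < T"
    "\<forall>\<^sub>F (s', y') in nhds (s, y). D s' y' - \<delta> * P s' y' - N * (max 0 (s' - t))\<^sup>2
      \<le> D s y - \<delta> * P s y - N * (max 0 (s - t))\<^sup>2"
proof -
  define \<theta> where "\<theta> = D t x - \<delta> * P t x"
  \<comment> \<open>With this value the time penalty at \<open>T\<close> equals the upper bound
    \<open>M\<close>, which leaves no positive value of \<open>F\<close> there.\<close>
  define N where "N = M / (T - t)\<^sup>2"
  define F where "F = (\<lambda>z. D (fst z) (snd z) - \<delta> * P (fst z) (snd z) - N * (max 0 (fst z - t))\<^sup>2)"
  define S where "S = {z \<in> {0<..T} \<times> UNIV. F z \<ge> \<theta>}"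
  have "\<theta> > 0" using pos by (simp add: \<theta>_def)
  have P_nonneg: "0 \<le> P s y" if "0 < s" "s \<le> T" for s y
    using P_ge[OF that, of y] order_trans zero_le_power2 by blast
  have "M > 0"
    using D_le[of t x] P_nonneg[of t x] pos t \<open>\<delta> > 0\<close> by (smt (verit) mult_nonneg_nonneg)
  then have "N \<ge> 0" by (simp add: N_def)
  have contF: "continuous_on ({0<..} \<times> UNIV) F"
    using contD contP unfolding F_def split_def
    by (intro continuous_intros continuous_on_max)
  have F_le: "F z \<le> D (fst z) (snd z) - \<delta> * P (fst z) (snd z)" for z
    using \<open>N \<ge> 0\<close> by (simp add: F_def)
  have bdd: "S \<subseteq> cbox (0, - (M / \<delta> + 1)) (T, M / \<delta> + 1)"
  proof
    fix z assume z: "z \<in> S"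
    then have s: "0 < fst z" "fst z \<le> T" by (auto simp: S_def)
    have "\<delta> * (snd z)\<^sup>2 \<le> \<delta> * P (fst z) (snd z)"
      using P_ge[OF s] \<open>\<delta> > 0\<close> by simp
    also have "\<dots> \<le> M"
      using D_le[OF s, of "snd z"] F_le[of z] z \<open>\<theta> > 0\<close> by (simp add: S_def)
    finally have "(snd z)\<^sup>2 \<le> M / \<delta>"
      using \<open>\<delta> > 0\<close> by (simp add: field_simps)
    \<comment> \<open>A square root is avoided by means of q \<le> (q + 1)^2.\<close>
    also have "\<dots> \<le> (M / \<delta> + 1)\<^sup>2"
    proof -
      have "q \<le> (q + 1)\<^sup>2" if "q \<ge> 0" for q :: real
        using that by (simp add: power2_eq_square algebra_simps)
      then show ?thesis using \<open>M > 0\<close> \<open>\<delta> > 0\<close> by simp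
    qed
    finally have "\<bar>snd z\<bar> \<le> M / \<delta> + 1"
      using \<open>M > 0\<close> \<open>\<delta> > 0\<close> by (intro power2_le_imp_le[of "\<bar>snd z\<bar>"]) auto
    then show "z \<in> cbox (0, - (M / \<delta> + 1)) (T, M / \<delta> + 1)"
      using s by (cases z) (auto simp: cbox_Pair_eq)
  qed
  \<comment> \<open>Only limit points at time 0 are critical, since continuity of \<open>F\<close>
    is available at positive times alone. There \<open>initial\<close> keeps the values below
    \<open>\<theta>\<close>, so no sequence in \<open>S\<close> converges to such a point.\<close>
  have "closed S"
    unfolding closed_sequential_limits
  proof (intro allI impI, elim conjE)
    fix z l assume z: "\<forall>n. z n \<in> S" and lim: "z \<longlonglongrightarrow> l"
    have "(\<lambda>n. fst (z n)) \<longlonglongrightarrow> fst l"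
      using lim by (rule tendsto_fst)
    then have l: "0 \<le> fst l" "fst l \<le> T"
      using z by (auto simp: S_def mem_Times_iff less_imp_le
          intro: LIMSEQ_le_const LIMSEQ_le_const2)
    show "l \<in> S"
    proof (cases "fst l = 0")
      case True
      have "z n \<in> {0<..} \<times> UNIV" and "z n \<noteq> l" for n
        using z[rule_format, of n] True by (auto simp: S_def mem_Times_iff)
      then have "filterlim z (at l within {0<..} \<times> UNIV) sequentially"
        using lim by (simp add: filterlim_at)
      moreover have "\<forall>\<^sub>F y in at l within {0<..} \<times> UNIV. D (fst y) (snd y) - \<delta> * P (fst y) (snd y) < \<theta>"
        using initial[OF \<open>\<theta> > 0\<close>, of "snd l"] True by (cases l) (simp add: split_def)
      ultimately have "\<forall>\<^sub>F n in sequentially. D (fst (z n)) (snd (z n)) - \<delta> * P (fst (z n)) (snd (z n)) < \<theta>"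
        by (auto simp: filterlim_iff)
      then have "\<forall>\<^sub>F n in sequentially. False"
      proof eventually_elim
        case (elim n)
        moreover have "\<theta> \<le> F (z n)" using z by (simp add: S_def)
        ultimately show ?case using F_le[of "z n"] by simp
      qed
      then show ?thesis by simp
    next
      case False
      with l have "isCont F l"
        using contF by (cases l) (auto simp: continuous_on_eq_continuous_at open_Times)
      then have "(\<lambda>n. F (z n)) \<longlonglongrightarrow> F l"
        using lim by (rule isCont_tendsto_compose)
      then have "\<theta> \<le> F l"
        using z by (intro LIMSEQ_le_const) (auto simp: S_def)
      then show ?thesis
        using l False by (cases l) (auto simp: S_def)
    qed
  qed
  moreover have "bounded S"
    using bdd bounded_cbox bounded_subset by blast
  ultimately have "compact S"
    by (simp add: compact_eq_bounded_closed)
  moreover have tx: "(t, x) \<in> S"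
    using t by (simp add: S_def F_def \<theta>_def)
  moreover have "continuous_on S F"
    by (rule continuous_on_subset[OF contF]) (auto simp: S_def)
  ultimately obtain z where z: "z \<in> S" "\<And>z'. z' \<in> S \<Longrightarrow> F z' \<le> F z"
    using continuous_attains_sup[of S F] by blast
  obtain s y where sy: "z = (s, y)" by force
  have s: "0 < s" "s \<le> T" using z(1) by (auto simp: S_def sy)
  have "s \<noteq> T"
  proof
    assume "s = T"
    then have "F z \<le> M - M"
      using D_le[OF s, of y] P_nonneg[OF s, of y] \<open>\<delta> > 0\<close> t
      by (simp add: F_def sy N_def) (smt (verit) mult_nonneg_nonneg)
    with z(1) \<open>\<theta> > 0\<close> show False by (simp add: S_def)
  qed
  with s have "s < T" by simp
  have "\<forall>\<^sub>F z' in nhds (s, y). z' \<in> {0<..<T} \<times> UNIV"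
    using s \<open>s < T\<close> by (intro eventually_nhds_in_open open_Times) auto
  \<comment> \<open>Nearby points of \<open>S\<close> are covered by maximality. All other nearby
    points have a value below \<open>\<theta>\<close>, hence below the maximum, which is therefore a
    local one in the open half-space.\<close>
  then have "\<forall>\<^sub>F z' in nhds (s, y). F z' \<le> F z"
  proof eventually_elim
    case (elim z')
    show ?case
    proof (cases "F z' \<ge> \<theta>")
      case True
      then show ?thesis using elim by (intro z(2)) (auto simp: S_def)
    next
      case False
      then show ?thesis using z(1) by (simp add: S_def)
    qed
  qed
  then show thesis
    using \<open>N \<ge> 0\<close> s(1) \<open>s < T\<close>
    by (intro that[of N s y]) (simp_all add: F_def sy split_def)
qed

text \<open>The strict inequality produces the contradiction at the touching point. The quadratic
  growth bounds the superlevel sets in space; it is asked only up to time \<open>T\<close>, where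
  the comparison takes place.\<close>

definition admissible_penalty :: "real \<Rightarrow> real \<Rightarrow> real \<Rightarrow> (real \<Rightarrow> real \<Rightarrow> real) \<Rightarrow>
    (real \<Rightarrow> real \<Rightarrow> real) \<Rightarrow> (real \<Rightarrow> real \<Rightarrow> real) \<Rightarrow> (real \<Rightarrow> real \<Rightarrow> real) \<Rightarrow> bool" where
  "admissible_penalty a b T P p q r \<longleftrightarrow> C12_on_halfspace P p q r \<and>
    (\<forall>t x. 0 < t \<longrightarrow> G_fun a b (r t x) < p t x) \<and>
    (\<forall>t x. 0 < t \<longrightarrow> t \<le> T \<longrightarrow> x\<^sup>2 \<le> P t x)"

text \<open>The square of a positive part is continuously differentiable once, which is the
  regularity that \<open>C12_on_halfspace\<close> asks for in time.\<close>

lemma C12_time_penalty: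
  "C12_on_halfspace (\<lambda>s y. N * (max 0 (s - t))\<^sup>2) (\<lambda>s y. 2 * N * max 0 (s - t)) (\<lambda>s y. 0) (\<lambda>s y. 0)"
proof (rule C12_on_halfspace_time)
  fix s :: real
  have "((\<lambda>s. if s \<le> t then 0 else N * (s - t)\<^sup>2) has_real_derivative
      (if s \<le> t then 0 else 2 * N * (s - t))) (at s)"
    by (rule DERIV_If_le) (auto intro!: derivative_eq_intros)
  moreover have "(\<lambda>s. N * (max 0 (s - t))\<^sup>2) = (\<lambda>s. if s \<le> t then 0 else N * (s - t)\<^sup>2)"
    and "2 * N * max 0 (s - t) = (if s \<le> t then 0 else 2 * N * (s - t))"
    by (auto simp: max_def)
  ultimately show "((\<lambda>s. N * (max 0 (s - t))\<^sup>2) has_real_derivative 2 * N * max 0 (s - t)) (at s)"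
    by simp
qed (intro continuous_intros)

text \<open>If \<open>w\<close> exceeded \<open>W\<close> somewhere, then \<open>W\<close> plus the
  penalties, being of class C^{1,2}, would be a test function touching \<open>w\<close> from above
  after a shift by a constant. The viscosity inequality and sublinearity of \<open>G_fun\<close>
  then contradict the strictness of the penalty.\<close>

lemma viscosity_subsolution_le:
  assumes ab: "a\<^sup>2 \<le> b\<^sup>2" and t: "0 < t" "t < T"
    and sub: "gheat_viscosity_subsolution a b w"
    and contw: "continuous_on ({0<..} \<times> UNIV) (\<lambda>(s, y). w s y)"
    and W: "C12_on_halfspace W p q r"
    and W_super: "\<And>s y. 0 < s \<Longrightarrow> s < T \<Longrightarrow> G_fun a b (r s y) \<le> p s y"
    and P: "admissible_penalty a b T P p' q' r'"
    and bound: "\<And>s y. 0 < s \<Longrightarrow> s \<le> T \<Longrightarrow> w s y - W s y \<le> M"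
    and initial: "\<And>y \<delta> \<theta>. \<delta> > 0 \<Longrightarrow> \<theta> > 0 \<Longrightarrow>
      \<forall>\<^sub>F (s, z) in at (0, y) within {0<..} \<times> UNIV. w s z - W s z - \<delta> * P s z < \<theta>"
  shows "w t x \<le> W t x"
proof (rule ccontr)
  assume "\<not> w t x \<le> W t x"
  \<comment> \<open>At most half of the excess is spent on the penalty; the summand 1 keeps the
    denominator positive.\<close>
  define \<delta> where "\<delta> = (w t x - W t x) / (2 * (\<bar>P t x\<bar> + 1))"
  have "\<delta> > 0"
    using \<open>\<not> w t x \<le> W t x\<close> by (simp add: \<delta>_def)
  have "\<delta> * P t x \<le> \<delta> * (\<bar>P t x\<bar> + 1)"
    using \<open>\<delta> > 0\<close> by (intro mult_left_mono) auto
  also have "\<dots> = (w t x - W t x) / 2"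
    by (simp add: \<delta>_def field_simps)
  also have "\<dots> < w t x - W t x"
    using \<open>\<not> w t x \<le> W t x\<close> by simp
  finally have pos: "\<delta> * P t x < w t x - W t x" .
  have CP: "C12_on_halfspace P p' q' r'"
    and P_super: "\<And>t x. 0 < t \<Longrightarrow> G_fun a b (r' t x) < p' t x"
    and P_ge: "\<And>t x. 0 < t \<Longrightarrow> t \<le> T \<Longrightarrow> x\<^sup>2 \<le> P t x"
    using P by (auto simp: admissible_penalty_def)
  have contD: "continuous_on ({0<..} \<times> UNIV) (\<lambda>(s, y). w s y - W s y)"
    using contw W by (auto simp: split_def C12_on_halfspace_def intro!: continuous_on_diff)
  have contP: "continuous_on ({0<..} \<times> UNIV) (\<lambda>(s, y). P s y)"
    using CP by (simp add: C12_on_halfspace_def)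
  obtain N s y where N: "N \<ge> 0" and s: "0 < s" "s < T"
    and max: "\<forall>\<^sub>F (s', y') in nhds (s, y).
      w s' y' - W s' y' - \<delta> * P s' y' - N * (max 0 (s' - t))\<^sup>2
      \<le> w s y - W s y - \<delta> * P s y - N * (max 0 (s - t))\<^sup>2"
    by (rule penalized_maximum[OF t \<open>\<delta> > 0\<close> contD contP bound P_ge initial[OF \<open>\<delta> > 0\<close>] pos])
  let ?\<psi> = "\<lambda>s y. W s y + \<delta> * P s y + N * (max 0 (s - t))\<^sup>2"
  let ?p = "\<lambda>s y. p s y + \<delta> * p' s y + 2 * N * max 0 (s - t)"
  let ?r = "\<lambda>s y. r s y + \<delta> * r' s y + 0"
  have C: "C12_on_halfspace ?\<psi> ?p (\<lambda>s y. q s y + \<delta> * q' s y + 0) ?r"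
    by (intro C12_on_halfspace_add C12_on_halfspace_cmult W CP C12_time_penalty)
  have "\<forall>\<^sub>F (s', y') in nhds (s, y). w s' y' - ?\<psi> s' y' \<le> w s y - ?\<psi> s y"
    using max by (rule eventually_mono) (auto simp: algebra_simps)
  with C s(1) have "?p s y \<le> G_fun a b (?r s y)"
    using sub unfolding gheat_viscosity_subsolution_def by blast
  also have "\<dots> \<le> G_fun a b (r s y) + \<delta> * G_fun a b (r' s y)"
    using G_fun_add_le[OF ab, of "r s y" "\<delta> * r' s y"] \<open>\<delta> > 0\<close> by (simp add: G_fun_cmult)
  also have "\<dots> < p s y + \<delta> * p' s y"
    using W_super[OF s] P_super[OF s(1)] \<open>\<delta> > 0\<close> by (intro add_le_less_mono) auto
  also have "\<dots> \<le> ?p s y"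
    using N by simp
  finally show False by simp
qed

text \<open>Here the penalties are subtracted from \<open>W\<close>. As \<open>G_fun\<close> is only
  subadditive, it is applied to the second derivative of \<open>W\<close> split as that of the test
  function plus the penalty's contribution, which again yields an upper bound.\<close>

lemma viscosity_supersolution_ge:
  assumes ab: "a\<^sup>2 \<le> b\<^sup>2" and t: "0 < t" "t < T"
    and super: "gheat_viscosity_supersolution a b w"
    and contw: "continuous_on ({0<..} \<times> UNIV) (\<lambda>(s, y). w s y)"
    and W: "C12_on_halfspace W p q r"
    and W_sub: "\<And>s y. 0 < s \<Longrightarrow> s < T \<Longrightarrow> p s y \<le> G_fun a b (r s y)"
    and P: "admissible_penalty a b T P p' q' r'"
    and bound: "\<And>s y. 0 < s \<Longrightarrow> s \<le> T \<Longrightarrow> W s y - w s y \<le> M"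
    and initial: "\<And>y \<delta> \<theta>. \<delta> > 0 \<Longrightarrow> \<theta> > 0 \<Longrightarrow>
      \<forall>\<^sub>F (s, z) in at (0, y) within {0<..} \<times> UNIV. W s z - w s z - \<delta> * P s z < \<theta>"
  shows "W t x \<le> w t x"
proof (rule ccontr)
  assume "\<not> W t x \<le> w t x"
  define \<delta> where "\<delta> = (W t x - w t x) / (2 * (\<bar>P t x\<bar> + 1))"
  have "\<delta> > 0"
    using \<open>\<not> W t x \<le> w t x\<close> by (simp add: \<delta>_def)
  have "\<delta> * P t x \<le> \<delta> * (\<bar>P t x\<bar> + 1)"
    using \<open>\<delta> > 0\<close> by (intro mult_left_mono) auto
  also have "\<dots> = (W t x - w t x) / 2"
    by (simp add: \<delta>_def field_simps)
  also have "\<dots> < W t x - w t x"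
    using \<open>\<not> W t x \<le> w t x\<close> by simp
  finally have pos: "\<delta> * P t x < W t x - w t x" .
  have CP: "C12_on_halfspace P p' q' r'"
    and P_super: "\<And>t x. 0 < t \<Longrightarrow> G_fun a b (r' t x) < p' t x"
    and P_ge: "\<And>t x. 0 < t \<Longrightarrow> t \<le> T \<Longrightarrow> x\<^sup>2 \<le> P t x"
    using P by (auto simp: admissible_penalty_def)
  have contD: "continuous_on ({0<..} \<times> UNIV) (\<lambda>(s, y). W s y - w s y)"
    using contw W by (auto simp: split_def C12_on_halfspace_def intro!: continuous_on_diff)
  have contP: "continuous_on ({0<..} \<times> UNIV) (\<lambda>(s, y). P s y)"
    using CP by (simp add: C12_on_halfspace_def)
  obtain N s y where N: "N \<ge> 0" and s: "0 < s" "s < T"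
    and max: "\<forall>\<^sub>F (s', y') in nhds (s, y).
      W s' y' - w s' y' - \<delta> * P s' y' - N * (max 0 (s' - t))\<^sup>2
      \<le> W s y - w s y - \<delta> * P s y - N * (max 0 (s - t))\<^sup>2"
    by (rule penalized_maximum[OF t \<open>\<delta> > 0\<close> contD contP bound P_ge initial[OF \<open>\<delta> > 0\<close>] pos])
  let ?\<psi> = "\<lambda>s y. W s y + (- \<delta>) * P s y + (- N) * (max 0 (s - t))\<^sup>2"
  let ?p = "\<lambda>s y. p s y + (- \<delta>) * p' s y + 2 * (- N) * max 0 (s - t)"
  let ?r = "\<lambda>s y. r s y + (- \<delta>) * r' s y + 0"
  have C: "C12_on_halfspace ?\<psi> ?p (\<lambda>s y. q s y + (- \<delta>) * q' s y + 0) ?r"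
    by (intro C12_on_halfspace_add C12_on_halfspace_cmult W CP C12_time_penalty)
  have "\<forall>\<^sub>F (s', y') in nhds (s, y). w s' y' - ?\<psi> s' y' \<ge> w s y - ?\<psi> s y"
    using max by (rule eventually_mono) (auto simp: algebra_simps)
  with C s(1) have "G_fun a b (?r s y) \<le> ?p s y"
    using super unfolding gheat_viscosity_supersolution_def by blast
  moreover have "G_fun a b (r s y) \<le> G_fun a b (?r s y) + \<delta> * G_fun a b (r' s y)"
    using G_fun_add_le[OF ab, of "?r s y" "\<delta> * r' s y"] \<open>\<delta> > 0\<close> by (simp add: G_fun_cmult)
  moreover have "\<delta> * G_fun a b (r' s y) < \<delta> * p' s y"
    using P_super[OF s(1)] \<open>\<delta> > 0\<close> by simp
  moreover have "0 \<le> N * max 0 (s - t)"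
    using N by simp
  ultimately show False
    using W_sub[OF s, of y] by simp
qed

section \<open>A penalty singular at the two jumps\<close>

text \<open>The offset makes the quadratic terms in \<open>two_point_penalty\<close> absorb the negative part of the
  logarithms for times up to \<open>T\<close>.\<close>

definition penalty_offset :: "real \<Rightarrow> real \<Rightarrow> real \<Rightarrow> real" where
  "penalty_offset b c T = 2 * c\<^sup>2 + 10 * b\<^sup>2 * T"

text \<open>Two of the three copies of \<open>x\<^sup>2\<close> absorb the logarithms and the third
  provides the growth. The rate \<open>3 * b\<^sup>2\<close> pays for the second derivative 6 of the
  quadratic term, and the extra 1 makes the supersolution strict. The affine arguments are written
  in the shape of \<open>C12_on_halfspace_affine\<close>.\<close>

definition two_point_penalty :: "real \<Rightarrow> real \<Rightarrow> real \<Rightarrow> real \<Rightarrow> real \<Rightarrow> real \<Rightarrow> real" where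
  "two_point_penalty a b c C t x =
    log_barrier (5 * b\<^sup>2) (30 * b ^ 4 / a\<^sup>2) t (1 * x + (- c)) +
    log_barrier (5 * b\<^sup>2) (30 * b ^ 4 / a\<^sup>2) t (1 * x + c) +
    (3 * x\<^sup>2 + ((3 * b\<^sup>2 + 1) * t + C))"

lemma C12_square: "C12_on_halfspace (\<lambda>t x. x\<^sup>2) (\<lambda>t x. 0) (\<lambda>t x. 2 * x) (\<lambda>t x. 2)"
  unfolding C12_on_halfspace_def split_def
  by (auto intro!: derivative_eq_intros continuous_intros)

lemma two_point_penalty_C12_super:
  assumes "0 < a" and "a \<le> b"
  obtains p q r where "C12_on_halfspace (two_point_penalty a b c C) p q r"
    and "\<And>t x. 0 < t \<Longrightarrow> G_fun a b (r t x) < p t x"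
proof -
  define K where "K = 5 * b\<^sup>2"
  define m where "m = 30 * b ^ 4 / a\<^sup>2"
  have "b > 0" using assms by simp
  then have "K > 0" by (simp add: K_def)
  have time: "C12_on_halfspace (\<lambda>t x. (3 * b\<^sup>2 + 1) * t + C) (\<lambda>t x. 3 * b\<^sup>2 + 1) (\<lambda>t x. 0) (\<lambda>t x. 0)"
    by (intro C12_on_halfspace_time) (auto intro!: derivative_eq_intros continuous_intros)
  let ?p = "\<lambda>t x. log_barrier_t K m t (1 * x + (- c)) + log_barrier_t K m t (1 * x + c) +
    (3 * 0 + (3 * b\<^sup>2 + 1))"
  let ?r = "\<lambda>t x. 1\<^sup>2 * log_barrier_xx K m t (1 * x + (- c)) + 1\<^sup>2 * log_barrier_xx K m t (1 * x + c) +
    (3 * 2 + 0)"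
  have "C12_on_halfspace (two_point_penalty a b c C) ?p
    (\<lambda>t x. 1 * log_barrier_x K m t (1 * x + (- c)) + 1 * log_barrier_x K m t (1 * x + c) +
      (3 * (2 * x) + 0)) ?r"
    unfolding two_point_penalty_def[abs_def] K_def[symmetric] m_def[symmetric]
    by (intro C12_on_halfspace_add C12_on_halfspace_cmult C12_square time
        C12_on_halfspace_affine[OF C12_log_barrier[OF \<open>K > 0\<close>]])
  moreover have "G_fun a b (?r t x) < ?p t x" if "0 < t" for t x
  proof -
    have ab: "a\<^sup>2 \<le> b\<^sup>2"
      using assms by (intro power_mono) auto
    note le = log_barrier_supersolution[OF assms that K_def m_def]
    have "G_fun a b (?r t x) \<le> G_fun a b (log_barrier_xx K m t (1 * x + (- c))) +
        G_fun a b (log_barrier_xx K m t (1 * x + c)) + G_fun a b 6"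
      using G_fun_add_le[OF ab, of "log_barrier_xx K m t (1 * x + (- c)) +
          log_barrier_xx K m t (1 * x + c)" 6]
        G_fun_add_le[OF ab, of "log_barrier_xx K m t (1 * x + (- c))" "log_barrier_xx K m t (1 * x + c)"]
      by simp
    also have "\<dots> \<le> log_barrier_t K m t (1 * x + (- c)) + log_barrier_t K m t (1 * x + c) + 3 * b\<^sup>2"
      by (intro add_mono le) (simp add: G_fun_nonneg_eq)
    also have "\<dots> < ?p t x" by simp
    finally show ?thesis .
  qed
  ultimately show thesis by (rule that)
qed

text \<open>The first bound keeps the singularity; the second, from ln y \<le> y - 1, limits the
  decay at spatial infinity.\<close>

lemma log_barrier_ge:
  assumes "m \<ge> 0" and "K > 0" and "t > 0"
  shows "- ln (x\<^sup>2 + K * t) \<le> log_barrier K m t x" and "1 - (x\<^sup>2 + K * t) \<le> log_barrier K m t x"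
proof -
  have pos: "x\<^sup>2 + K * t > 0" using assms by (intro add_nonneg_pos) auto
  show "- ln (x\<^sup>2 + K * t) \<le> log_barrier K m t x"
    using pos assms by (simp add: log_barrier_def)
  moreover have "ln (x\<^sup>2 + K * t) \<le> x\<^sup>2 + K * t - 1"
    using pos by (rule ln_le_minus_one)
  ultimately show "1 - (x\<^sup>2 + K * t) \<le> log_barrier K m t x"
    by simp
qed

text \<open>Any logarithm not displayed is estimated by the second bound of
  \<open>log_barrier_ge\<close>, at a cost covered by the quadratic term and the offset. This gives
  growth in space and blow-up at \<open>(0, c)\<close> and \<open>(0, - c)\<close>.\<close>

lemma two_point_penalty_ge:
  assumes "0 < a" and "a \<le> b" and t: "0 < t" "t \<le> T"
  shows "x\<^sup>2 \<le> two_point_penalty a b c (penalty_offset b c T) t x"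
    and "- ln ((x - c)\<^sup>2 + 5 * b\<^sup>2 * t) \<le> two_point_penalty a b c (penalty_offset b c T) t x"
    and "- ln ((x + c)\<^sup>2 + 5 * b\<^sup>2 * t) \<le> two_point_penalty a b c (penalty_offset b c T) t x"
proof -
  have pos: "30 * b ^ 4 / a\<^sup>2 \<ge> 0" "5 * b\<^sup>2 > 0"
    using assms by auto
  note m = log_barrier_ge[OF pos t(1), of "x - c"] and p = log_barrier_ge[OF pos t(1), of "x + c"]
  have "b\<^sup>2 * t \<le> b\<^sup>2 * T"
    using t by (intro mult_left_mono) auto
  moreover have "(3 * b\<^sup>2 + 1) * t \<ge> 0" and "0 \<le> (x - c)\<^sup>2" and "0 \<le> (x + c)\<^sup>2" and "b\<^sup>2 * t \<ge> 0"
    using t by auto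
  moreover have "(x - c)\<^sup>2 + (x + c)\<^sup>2 = 2 * x\<^sup>2 + 2 * c\<^sup>2"
    by (simp add: power2_eq_square algebra_simps)
  moreover have "x\<^sup>2 \<ge> 0" by simp
  ultimately show "x\<^sup>2 \<le> two_point_penalty a b c (penalty_offset b c T) t x"
    and "- ln ((x - c)\<^sup>2 + 5 * b\<^sup>2 * t) \<le> two_point_penalty a b c (penalty_offset b c T) t x"
    and "- ln ((x + c)\<^sup>2 + 5 * b\<^sup>2 * t) \<le> two_point_penalty a b c (penalty_offset b c T) t x"
    using m p unfolding two_point_penalty_def penalty_offset_def mult_1 add_uminus_conv_diff
    by linarith+
qed

lemma eventually_log_singularity_gt:
  fixes B y K :: real
  assumes "K > 0"
  shows "\<forall>\<^sub>F (s, z) in at (0, y) within {0<..} \<times> UNIV. B < - ln ((z - y)\<^sup>2 + K * s)"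
proof -
  let ?F = "at (0::real, y) within {0<..} \<times> UNIV"
  have f: "(fst \<longlongrightarrow> 0) ?F" and sn: "(snd \<longlongrightarrow> y) ?F"
    using tendsto_fst[OF tendsto_ident_at, of "(0::real, y)"]
      tendsto_snd[OF tendsto_ident_at, of "(0::real, y)"] by simp_all
  have "((\<lambda>z. (snd z - y)\<^sup>2 + K * fst z) \<longlongrightarrow> (y - y)\<^sup>2 + K * 0) ?F"
    by (intro tendsto_add tendsto_power tendsto_diff tendsto_mult_left tendsto_const f sn)
  then have "((\<lambda>z. (snd z - y)\<^sup>2 + K * fst z) \<longlongrightarrow> 0) (at (0::real, y) within {0<..} \<times> UNIV)"
    by simp
  then have "\<forall>\<^sub>F z in at (0::real, y) within {0<..} \<times> UNIV. (snd z - y)\<^sup>2 + K * fst z < exp (- B)"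
    by (rule order_tendstoD) simp
  moreover have "\<forall>\<^sub>F z in at (0::real, y) within {0<..} \<times> UNIV. z \<in> {0<..} \<times> UNIV"
    by (simp add: eventually_at_filter)
  ultimately show ?thesis
  proof eventually_elim
    case (elim z)
    then have "(snd z - y)\<^sup>2 + K * fst z > 0"
      using assms by (intro add_nonneg_pos) (auto simp: mem_Times_iff)
    with elim have "ln ((snd z - y)\<^sup>2 + K * fst z) < - B"
      by (metis exp_gt_zero ln_exp ln_less_cancel_iff)
    then show ?case by (simp add: split_def)
  qed
qed

text \<open>Delivers the initial condition of the comparison principles. Near the jumps
  \<open>D\<close> is merely bounded, but the penalty exceeds \<open>M / \<delta>\<close>; elsewhere
  the limit of \<open>D\<close> decides, because the penalty is nonnegative.\<close>

lemma eventually_penalized_less: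
  assumes "0 < a" and "a \<le> b" and "T > 0" and "\<delta> > 0" and "\<theta> > 0"
    and bound: "\<And>s z. 0 < s \<Longrightarrow> s \<le> T \<Longrightarrow> D s z \<le> M"
    and limit: "\<And>y. y \<noteq> c \<Longrightarrow> y \<noteq> - c \<Longrightarrow>
      \<forall>\<^sub>F (s, z) in at (0, y) within {0<..} \<times> UNIV. D s z < \<theta>"
  shows "\<forall>\<^sub>F (s, z) in at (0, y) within {0<..} \<times> UNIV.
    D s z - \<delta> * two_point_penalty a b c (penalty_offset b c T) s z < \<theta>"
proof -
  let ?P = "two_point_penalty a b c (penalty_offset b c T)"
  let ?F = "at (0::real, y) within {0<..} \<times> UNIV"
  have "(fst \<longlongrightarrow> fst (0::real, y)) ?F"
    by (rule tendsto_fst[OF tendsto_ident_at])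
  then have "\<forall>\<^sub>F z in ?F. fst z < T"
    using \<open>T > 0\<close> by (intro order_tendstoD) auto
  moreover have "\<forall>\<^sub>F z in ?F. z \<in> {0<..} \<times> UNIV"
    by (simp add: eventually_at_filter)
  ultimately have small: "\<forall>\<^sub>F z in ?F. 0 < fst z \<and> fst z \<le> T"
    by eventually_elim (auto simp: mem_Times_iff)
  have "5 * b\<^sup>2 > 0" using assms by simp
  note sing = eventually_log_singularity_gt[OF this, of "M / \<delta>"]
  note P_ge = two_point_penalty_ge[OF assms(1,2)]
  consider "y = c" | "y = - c" | "y \<noteq> c" "y \<noteq> - c" by blast
  then show ?thesis
  proof cases
    case 1
    have "\<forall>\<^sub>F z in ?F. M / \<delta> < ?P (fst z) (snd z)"
      using small sing[of y]
    proof eventually_elim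
      case (elim z)
      then show ?case using P_ge(2)[of "fst z" T "snd z" c] 1 by (simp add: split_def)
    qed
    with small show ?thesis
    proof eventually_elim
      case (elim z)
      then show ?case using bound[of "fst z" "snd z"] \<open>\<delta> > 0\<close> \<open>\<theta> > 0\<close>
        by (simp add: split_def field_simps)
    qed
  next
    case 2
    have "\<forall>\<^sub>F z in ?F. M / \<delta> < ?P (fst z) (snd z)"
      using small sing[of y]
    proof eventually_elim
      case (elim z)
      then show ?case using P_ge(3)[of "fst z" T "snd z" c] 2 by (simp add: split_def)
    qed
    with small show ?thesis
    proof eventually_elim
      case (elim z)
      then show ?case using bound[of "fst z" "snd z"] \<open>\<delta> > 0\<close> \<open>\<theta> > 0\<close>
        by (simp add: split_def field_simps)
    qed
  next
    case 3
    from small limit[OF 3] show ?thesis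
    proof eventually_elim
      case (elim z)
      then have "0 \<le> ?P (fst z) (snd z)"
        using P_ge(1)[of "fst z" T "snd z" c] order_trans[OF zero_le_power2] by blast
      with elim \<open>\<delta> > 0\<close> show ?case
        by (simp add: split_def) (smt (verit) mult_nonneg_nonneg)
    qed
  qed
qed

section \<open>The superposition defect\<close>

definition superposition_error :: "real \<Rightarrow> real \<Rightarrow> real \<Rightarrow> real \<Rightarrow> real" where
  "superposition_error a b c t = 2 * (b - a) / b * std_normal_cdf (- (2 * c) / (b * sqrt t))"

text \<open>Arranged as a multiple of \<open>x * std_normal_density x\<close> at
  \<open>x = 2 * c / (b * sqrt t)\<close>, the shape in which the defect appears.\<close>

definition superposition_error_t :: "real \<Rightarrow> real \<Rightarrow> real \<Rightarrow> real \<Rightarrow> real" where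
  "superposition_error_t a b c t = (b - a) / (b * t) *
    (2 * c / (b * sqrt t) * std_normal_density (2 * c / (b * sqrt t)))"

lemma DERIV_superposition_error:
  assumes "0 < b" and "t > 0"
  shows "(superposition_error a b c has_real_derivative superposition_error_t a b c t) (at t)"
proof -
  have "((\<lambda>t. - (2 * c) / (b * sqrt t)) has_real_derivative
      (2 * c / (b * sqrt t)) / (2 * t)) (at t)"
    using assms by (auto intro!: derivative_eq_intros simp: field_simps)
  from DERIV_cmult[OF DERIV_chain2[OF DERIV_std_normal_cdf this], of "2 * (b - a) / b"]
  have "(superposition_error a b c has_real_derivative 2 * (b - a) / b *
      (std_normal_density (- (2 * c) / (b * sqrt t)) * (2 * c / (b * sqrt t) / (2 * t)))) (at t)"
    by (simp add: superposition_error_def[abs_def])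
  also have "std_normal_density (- (2 * c) / (b * sqrt t)) = std_normal_density (2 * c / (b * sqrt t))"
    using std_normal_density_minus[of "2 * c / (b * sqrt t)"] by simp
  also have "2 * (b - a) / b *
      (std_normal_density (2 * c / (b * sqrt t)) * (2 * c / (b * sqrt t) / (2 * t))) =
      superposition_error_t a b c t"
    using assms by (simp add: superposition_error_t_def field_simps)
  finally show ?thesis .
qed

lemma continuous_on_superposition_error_t:
  assumes "0 < b"
  shows "continuous_on {0<..} (superposition_error_t a b c)"
proof -
  have *: "continuous_on {0<..} (\<lambda>t. 2 * c / (b * sqrt t))"
    using assms by (intro continuous_intros) auto
  show ?thesis
    unfolding superposition_error_t_def[abs_def] using assms
    by (intro continuous_on_mult[OF _ continuous_on_mult[OF * continuous_on_std_normal_density[OF *]]]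
        continuous_intros) auto
qed

lemma superposition_error_nonneg:
  assumes "0 < b" and "a \<le> b"
  shows "superposition_error a b c t \<ge> 0"
  using assms by (simp add: superposition_error_def cdf_def)

lemma superposition_error_t_nonneg:
  assumes "0 < b" and "a \<le> b" and "c \<ge> 0" and "t \<ge> 0"
  shows "superposition_error_t a b c t \<ge> 0"
  using assms by (simp add: superposition_error_t_def)

text \<open>The derivative is (1 - z^2) \<phi>(z), which is nonpositive from 1 on.\<close>

lemma mult_std_normal_density_antimono:
  assumes "1 \<le> x" and "x \<le> y"
  shows "y * std_normal_density y \<le> x * std_normal_density x"
proof (rule DERIV_nonpos_imp_nonincreasing[OF assms(2)])
  fix z assume "x \<le> z" "z \<le> y"
  have "((\<lambda>z. z * std_normal_density z) has_real_derivative
      1 * std_normal_density z + - z * std_normal_density z * z) (at z)"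
    by (rule DERIV_mult[OF DERIV_ident DERIV_std_normal_density])
  moreover have "std_normal_density z \<le> z\<^sup>2 * std_normal_density z"
    using mult_right_mono[of 1 "z\<^sup>2" "std_normal_density z"] \<open>x \<le> z\<close> assms(1)
    by (simp add: one_le_power)
  then have "1 * std_normal_density z + - z * std_normal_density z * z \<le> 0"
    by (simp add: power2_eq_square mult_ac)
  ultimately show "\<exists>d. ((\<lambda>z. z * std_normal_density z) has_real_derivative d) (at z) \<and> d \<le> 0"
    by blast
qed

text \<open>\<open>y\<close> is the argument of the concave wave and \<open>z\<close> that of the
  convex one. Keeping both general serves the two sides \<open>x > c\<close> and
  \<open>x < - c\<close> at once.\<close>

lemma superposition_defect_outside_le:
  assumes "0 < a" and "a \<le> b" and "t > 0" and "b * sqrt t \<le> 2 * c"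
    and "0 \<le> y" and z: "z \<le> - (2 * c)"
  shows "G_fun a b (selfsimilar_xx a b t y) + G_fun a b (selfsimilar_xx a b t z)
    - superposition_error_t a b c t
    \<le> G_fun a b (selfsimilar_xx a b t y + selfsimilar_xx a b t z)"
proof -
  let ?A = "selfsimilar_xx a b t y" and ?B = "selfsimilar_xx a b t z"
  let ?h = "\<lambda>x. x * std_normal_density x"
  have b: "b > 0" and ab: "a\<^sup>2 \<le> b\<^sup>2"
    using assms by (auto intro: power_mono)
  have bt: "b * sqrt t > 0" using b \<open>t > 0\<close> by simp
  with assms have "z \<le> 0" by linarith
  have A: "?A \<le> 0" and B: "?B \<ge> 0"
    using selfsimilar_xx_sign[of a b t] assms b \<open>z \<le> 0\<close> by auto
  \<comment> \<open>\<open>G_fun\<close> of the sum is at least its value with variance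
    \<open>a\<^sup>2\<close>. Against this bound the concave summand cancels, and the convex one
    remains with the difference of the variances.\<close>
  have "G_fun a b ?A + G_fun a b ?B - a\<^sup>2 / 2 * (?A + ?B) = (b\<^sup>2 - a\<^sup>2) / 2 * ?B"
    using A B by (simp add: G_fun_nonpos_eq G_fun_nonneg_eq field_simps)
  also have "\<dots> = (b - a) / (b * t) * ?h (- z / (b * sqrt t))"
  proof -
    have "std_normal_density (- z / (b * sqrt t)) = std_normal_density (z / sqrt t / b)"
      using std_normal_density_minus[of "z / (b * sqrt t)"] by (simp add: mult.commute)
    \<comment> \<open>The factor \<open>b + a\<close> cancels the normalisation
      \<open>2 / (b + a)\<close> of the profile.\<close>
    moreover have "b\<^sup>2 - a\<^sup>2 = (b - a) * (b + a)"
      by (simp add: power2_eq_square algebra_simps)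
    moreover have "b + a > 0" using assms(1) b by simp
    ultimately show ?thesis
      using \<open>z \<le> 0\<close> b \<open>t > 0\<close>
      by (simp add: selfsimilar_xx_def f_profile''_def f_profile'_def divide_le_0_iff
          power2_eq_square)
  qed
  \<comment> \<open>Both arguments are at least 1 since \<open>b * sqrt t \<le> 2 * c\<close>, so
    the monotone range applies.\<close>
  also have "\<dots> \<le> (b - a) / (b * t) * ?h (2 * c / (b * sqrt t))"
    using assms b bt
    by (intro mult_left_mono mult_std_normal_density_antimono divide_right_mono) auto
  finally show ?thesis
    using G_fun_ge[of a "a\<^sup>2" b "?A + ?B"] ab by (simp add: superposition_error_t_def)
qed

text \<open>Between \<open>- c\<close> and \<open>c\<close> both waves are convex and
  \<open>G_fun\<close> is additive, so the defect vanishes; outside, the preceding estimate applies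
  with the roles of the waves fixed by the sign of \<open>x\<close>.\<close>

lemma superposition_defect_le:
  assumes "0 < a" and "a \<le> b" and "t > 0" and "b * sqrt t \<le> 2 * c"
  shows "G_fun a b (selfsimilar_xx a b t (x - c)) + G_fun a b (selfsimilar_xx a b t (- x - c))
    - superposition_error_t a b c t
    \<le> G_fun a b (selfsimilar_xx a b t (x - c) + selfsimilar_xx a b t (- x - c))"
proof -
  have "b > 0" using assms by simp
  then have "b * sqrt t \<ge> 0" using assms by simp
  then have "c \<ge> 0" using assms by linarith
  consider "x > c" | "x < - c" | "x \<le> c" "- x \<le> c" by linarith
  then show ?thesis
  proof cases
    case 1
    then show ?thesis
      using superposition_defect_outside_le[OF assms, of "x - c" "- x - c"] by simp
  next
    case 2
    then show ?thesis
      using superposition_defect_outside_le[OF assms, of "- x - c" "x - c"]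
      by (simp add: add.commute)
  next
    case 3
    then have "selfsimilar_xx a b t (x - c) \<ge> 0" and "selfsimilar_xx a b t (- x - c) \<ge> 0"
      using assms \<open>b > 0\<close> by (auto intro!: selfsimilar_xx_sign)
    then show ?thesis
      using superposition_error_t_nonneg[OF \<open>b > 0\<close> assms(2) \<open>c \<ge> 0\<close>] assms(3)
      by (simp add: G_fun_nonneg_eq distrib_left)
  qed
qed

section \<open>Bounds and initial values of the waves\<close>

lemma f_profile_bounds:
  assumes "0 < a" and "a \<le> b"
  shows "0 \<le> f_profile a b y" and "f_profile a b y \<le> 2"
proof -
  have b: "b > 0" using assms by simp
  have cdf: "0 \<le> std_normal_cdf z" "std_normal_cdf z \<le> 1" for z
    using real_distribution.cdf_bounded_prob[OF real_dist_normal_dist] by (simp_all add: cdf_def)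
  let ?g = "if y \<le> 0 then b * std_normal_cdf (y / b) else a * std_normal_cdf (y / a) + (b - a) / 2"
  have "0 \<le> ?g"
    using cdf assms by auto
  then show "0 \<le> f_profile a b y"
    unfolding f_profile_eq[OF assms(1) b] using assms(1) b
    by (intro mult_nonneg_nonneg) auto
  have le: "b * std_normal_cdf (y / b) \<le> b" "a * std_normal_cdf (y / a) \<le> a"
    using assms b by (auto intro!: mult_left_le cdf)
  \<comment> \<open>A crude estimate, leading to 2 instead of the sharp bound 1; the comparison only
    asks for boundedness.\<close>
  have "?g \<le> b + a"
  proof (cases "y \<le> 0")
    case True
    have "b * std_normal_cdf (y / b) \<le> b + a" using le(1) assms(1) by linarith
    with True show ?thesis by simp
  next
    case False
    have "a * std_normal_cdf (y / a) + (b - a) / 2 \<le> b + a" using le(2) assms b by argo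
    with False show ?thesis by simp
  qed
  then have "2 / (b + a) * ?g \<le> 2 / (b + a) * (b + a)"
    using assms(1) b by (intro mult_left_mono) auto
  also have "\<dots> = 2"
    using assms(1) b by (simp add: divide_eq_eq)
  finally show "f_profile a b y \<le> 2"
    unfolding f_profile_eq[OF assms(1) b] .
qed

text \<open>Away from the jump the numerator has a nonzero limit while \<open>sqrt s\<close> tends
  to 0 from above, so the argument of the profile runs to plus or minus infinity.\<close>

lemma selfsimilar_initial:
  assumes "0 < a" and "0 < b" and nz: "e * y + d \<noteq> 0"
  shows "((\<lambda>(s, z). selfsimilar a b s (e * z + d)) \<longlongrightarrow> of_bool (e * y + d > 0))
    (at (0, y) within {0<..} \<times> UNIV)"
proof -
  let ?F = "at (0::real, y) within {0<..} \<times> UNIV"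
  have f: "(fst \<longlongrightarrow> 0) ?F" and sn: "(snd \<longlongrightarrow> y) ?F"
    using tendsto_fst[OF tendsto_ident_at, of "(0::real, y)"]
      tendsto_snd[OF tendsto_ident_at, of "(0::real, y)"] by simp_all
  have num: "((\<lambda>z. e * snd z + d) \<longlongrightarrow> e * y + d) ?F"
    by (intro tendsto_add tendsto_mult_left tendsto_const sn)
  have "((\<lambda>z. sqrt (fst z)) \<longlongrightarrow> 0) ?F"
    using tendsto_real_sqrt[OF f] by simp
  moreover have "\<forall>\<^sub>F z in ?F. 0 < sqrt (fst z)"
    by (auto simp: eventually_at_filter mem_Times_iff intro!: always_eventually)
  ultimately have inv: "filterlim (\<lambda>z. inverse (sqrt (fst z))) at_top ?F"
    by (rule filterlim_inverse_at_top)
  show ?thesis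
  proof (cases "e * y + d > 0")
    case True
    have "filterlim (\<lambda>z. (e * snd z + d) * inverse (sqrt (fst z))) at_top ?F"
      by (rule filterlim_tendsto_pos_mult_at_top[OF num True inv])
    from filterlim_compose[OF f_profile_at_top[OF assms(1,2)] this] True show ?thesis
      by (simp add: selfsimilar_def split_def divide_inverse)
  next
    case False
    with nz have neg: "e * y + d < 0" by simp
    have "filterlim (\<lambda>z. (e * snd z + d) * inverse (sqrt (fst z))) at_bot ?F"
      by (rule filterlim_tendsto_neg_mult_at_bot[OF num neg inv])
    from filterlim_compose[OF f_profile_at_bot[OF assms(1,2)] this] False show ?thesis
      by (simp add: selfsimilar_def split_def divide_inverse)
  qed
qed

lemma isCont_of_bool_abs_gt:
  fixes y c :: real
  assumes "y \<noteq> c" and "y \<noteq> - c" and "c > 0"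
  shows "isCont (\<lambda>y. of_bool (\<bar>y\<bar> > c) :: real) y"
proof -
  have "\<bar>y\<bar> < c \<or> \<bar>y\<bar> > c"
    using assms by linarith
  moreover have "open {z::real. \<bar>z\<bar> < c}" and "open {z::real. \<bar>z\<bar> > c}"
    by (auto intro!: open_Collect_less continuous_intros)
  ultimately have "\<forall>\<^sub>F z in nhds y. of_bool (\<bar>z\<bar> > c) = (of_bool (\<bar>y\<bar> > c) :: real)"
  proof (elim disjE)
    assume "\<bar>y\<bar> < c" "open {z::real. \<bar>z\<bar> < c}"
    then have "\<forall>\<^sub>F z in nhds y. z \<in> {z. \<bar>z\<bar> < c}"
      by (intro eventually_nhds_in_open) auto
    then show ?thesis by eventually_elim (use \<open>\<bar>y\<bar> < c\<close> in auto)
  next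
    assume "\<bar>y\<bar> > c" "open {z::real. \<bar>z\<bar> > c}"
    then have "\<forall>\<^sub>F z in nhds y. z \<in> {z. \<bar>z\<bar> > c}"
      by (intro eventually_nhds_in_open) auto
    then show ?thesis by eventually_elim (use \<open>\<bar>y\<bar> > c\<close> in auto)
  qed
  from isCont_cong[OF this] show ?thesis by simp
qed

section \<open>The upper and lower comparison for \<open>w\<close>\<close>

lemma superposition_bounds:
  assumes a: "0 < a" and ab: "a \<le> b" and "0 < t" and c: "b * sqrt t < 2 * c"
    and w: "gheat_cauchy_solution a b (\<lambda>y. of_bool (\<bar>y\<bar> > c)) w"
  shows "w t x \<le> selfsimilar a b t (x - c) + selfsimilar a b t (- x - c)"
    and "selfsimilar a b t (x - c) + selfsimilar a b t (- x - c) - superposition_error a b c t \<le> w t x"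
proof -
  have b: "b > 0" and ab2: "a\<^sup>2 \<le> b\<^sup>2"
    using a ab by (auto intro: power_mono)
  have "0 < b * sqrt t" using b \<open>0 < t\<close> by simp
  with c have "c > 0" by linarith
  have "sqrt t < 2 * c / b"
    using c b by (simp add: field_simps)
  then have "t < (2 * c / b)\<^sup>2"
    using power_strict_mono[of "sqrt t" "2 * c / b" 2] \<open>0 < t\<close> by simp
  \<comment> \<open>The bound on \<open>c\<close> is strict, so it persists a little beyond
    \<open>t\<close>. This leaves room for the time penalty, which acts between \<open>t\<close> and
    \<open>T\<close>.\<close>
  then obtain T where T: "t < T" "T < (2 * c / b)\<^sup>2"
    using dense by blast
  have T_pos: "T > 0" using T(1) \<open>0 < t\<close> by simp
  have sqrt_le: "b * sqrt s \<le> 2 * c" if "s < T" for s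
  proof -
    have "sqrt s \<le> sqrt ((2 * c / b)\<^sup>2)"
      using that T by (intro real_sqrt_le_mono) simp
    also have "\<dots> = 2 * c / b"
      using b \<open>c > 0\<close> by simp
    finally show ?thesis using b by (simp add: field_simps)
  qed
  \<comment> \<open>The factors \<open>1\<close> and \<open>- 1\<close> are left unsimplified so
    that the rule for affine substitutions matches syntactically.\<close>
  let ?W = "\<lambda>t x. selfsimilar a b t (1 * x + (- c)) + selfsimilar a b t ((- 1) * x + (- c))"
  let ?p = "\<lambda>t x. selfsimilar_t a b t (1 * x + (- c)) + selfsimilar_t a b t ((- 1) * x + (- c))"
  let ?q = "\<lambda>t x. 1 * selfsimilar_x a b t (1 * x + (- c)) + (- 1) * selfsimilar_x a b t ((- 1) * x + (- c))"
  let ?r = "\<lambda>t x. 1\<^sup>2 * selfsimilar_xx a b t (1 * x + (- c)) + (- 1)\<^sup>2 * selfsimilar_xx a b t ((- 1) * x + (- c))"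
  let ?E = "superposition_error a b c" and ?E' = "superposition_error_t a b c"
  have CW: "C12_on_halfspace ?W ?p ?q ?r"
    by (intro C12_on_halfspace_add C12_on_halfspace_affine C12_selfsimilar a b)
  have CZ: "C12_on_halfspace (\<lambda>t x. ?W t x + (- 1) * ?E t) (\<lambda>t x. ?p t x + (- 1) * ?E' t)
      (\<lambda>t x. ?q t x + (- 1) * 0) (\<lambda>t x. ?r t x + (- 1) * 0)"
    by (intro C12_on_halfspace_add[OF CW] C12_on_halfspace_cmult C12_on_halfspace_time
        DERIV_superposition_error continuous_on_superposition_error_t b)
  obtain p' q' r' where "C12_on_halfspace (two_point_penalty a b c (penalty_offset b c T)) p' q' r'"
    and "\<And>t x. 0 < t \<Longrightarrow> G_fun a b (r' t x) < p' t x"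
    using two_point_penalty_C12_super[OF a ab] by metis
  then have P: "admissible_penalty a b T (two_point_penalty a b c (penalty_offset b c T)) p' q' r'"
    using two_point_penalty_ge(1)[OF a ab] by (simp add: admissible_penalty_def)
  have sub: "gheat_viscosity_subsolution a b w" and super: "gheat_viscosity_supersolution a b w"
    and contw: "continuous_on ({0<..} \<times> UNIV) (\<lambda>(s, y). w s y)"
    using w by (auto simp: gheat_cauchy_solution_def gheat_viscosity_solution_def)
  obtain M where "\<forall>z\<in>(\<lambda>(t, x). w t x) ` ({0..} \<times> UNIV). norm z \<le> M"
    using w unfolding gheat_cauchy_solution_def bounded_iff by blast
  then have M: "\<bar>w s y\<bar> \<le> M" if "s > 0" for s y
    using that by force
  have W: "0 \<le> ?W s y" "?W s y \<le> 4" for s y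
    using f_profile_bounds[OF a ab] by (simp_all add: selfsimilar_def add_mono[of _ 2 _ 2, simplified])
  note E = superposition_error_nonneg[OF b ab, of c]
  \<comment> \<open>As \<open>c > 0\<close>, the two initial indicators have disjoint supports and
    add up to the datum of \<open>w\<close>; the jumps are left to the penalty.\<close>
  have diff: "((\<lambda>(s, z). w s z - ?W s z) \<longlongrightarrow> 0) (at (0, y) within {0<..} \<times> UNIV)"
    if "y \<noteq> c" "y \<noteq> - c" for y
  proof -
    have "((\<lambda>(s, z). w s z) \<longlongrightarrow> of_bool (\<bar>y\<bar> > c)) (at (0, y) within {0<..} \<times> UNIV)"
      using w isCont_of_bool_abs_gt[OF that \<open>c > 0\<close>] by (auto simp: gheat_cauchy_solution_def)
    moreover have "1 * y + (- c) \<noteq> 0" "(- 1) * y + (- c) \<noteq> 0"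
      using that by auto
    note selfsimilar_initial[OF a b this(1)] selfsimilar_initial[OF a b this(2)]
    ultimately have "((\<lambda>z. w (fst z) (snd z) - ?W (fst z) (snd z)) \<longlongrightarrow>
        of_bool (\<bar>y\<bar> > c) - (of_bool (1 * y + (- c) > 0) + of_bool ((- 1) * y + (- c) > 0)))
        (at (0, y) within {0<..} \<times> UNIV)"
      unfolding split_def by (intro tendsto_diff tendsto_add)
    moreover have "of_bool (\<bar>y\<bar> > c) - (of_bool (1 * y + (- c) > 0) + of_bool ((- 1) * y + (- c) > 0)) = (0::real)"
      using \<open>c > 0\<close> by auto
    ultimately show ?thesis by (simp add: split_def)
  qed
  have "w t x \<le> ?W t x"
  proof (rule viscosity_subsolution_le[OF ab2 \<open>0 < t\<close> T(1) sub contw CW _ P])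
    show "G_fun a b (?r s y) \<le> ?p s y" if "0 < s" for s y
      using G_fun_add_le[OF ab2, of "selfsimilar_xx a b s (y - c)" "selfsimilar_xx a b s (- y - c)"]
      by (simp add: selfsimilar_gheat[OF a b that])
    show bound: "w s y - ?W s y \<le> M" if "0 < s" for s y
      using M[OF that, of y] W(1)[of s y] by linarith
    show "\<forall>\<^sub>F (s, z) in at (0, y) within {0<..} \<times> UNIV. w s z - ?W s z -
        \<delta> * two_point_penalty a b c (penalty_offset b c T) s z < \<theta>" if "\<delta> > 0" "\<theta> > 0" for y \<delta> \<theta>
    proof (rule eventually_penalized_less[OF a ab T_pos that bound])
      fix y assume "y \<noteq> c" "y \<noteq> - c"
      from order_tendstoD(2)[OF diff[OF this] \<open>\<theta> > 0\<close>]
      show "\<forall>\<^sub>F (s, z) in at (0, y) within {0<..} \<times> UNIV. w s z - ?W s z < \<theta>"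
        by (simp add: split_def)
    qed
  qed
  then show "w t x \<le> selfsimilar a b t (x - c) + selfsimilar a b t (- x - c)"
    by simp
  have "?W t x + (- 1) * ?E t \<le> w t x"
  proof (rule viscosity_supersolution_ge[OF ab2 \<open>0 < t\<close> T(1) super contw CZ _ P])
    show "?p s y + (- 1) * ?E' s \<le> G_fun a b (?r s y + (- 1) * 0)" if "0 < s" "s < T" for s y
      using superposition_defect_le[OF a ab that(1) sqrt_le[OF that(2)], of y]
      by (simp add: selfsimilar_gheat[OF a b that(1)])
    show bound: "?W s y + (- 1) * ?E s - w s y \<le> 4 + M" if "0 < s" for s y
      using M[OF that, of y] W(2)[of s y] E[of s] by linarith
    show "\<forall>\<^sub>F (s, z) in at (0, y) within {0<..} \<times> UNIV. ?W s z + (- 1) * ?E s - w s z -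
        \<delta> * two_point_penalty a b c (penalty_offset b c T) s z < \<theta>" if "\<delta> > 0" "\<theta> > 0" for y \<delta> \<theta>
    proof (rule eventually_penalized_less[OF a ab T_pos that bound])
      fix y assume "y \<noteq> c" "y \<noteq> - c"
      from order_tendstoD(1)[OF diff[OF this], of "- \<theta>"] \<open>\<theta> > 0\<close>
      have "\<forall>\<^sub>F z in at (0, y) within {0<..} \<times> UNIV. - \<theta> < w (fst z) (snd z) - ?W (fst z) (snd z)"
        by (simp add: split_def)
      \<comment> \<open>The sign of \<open>?E\<close> suffices, since subtracting it only lowers the
        difference.\<close>
      then show "\<forall>\<^sub>F (s, z) in at (0, y) within {0<..} \<times> UNIV. ?W s z + (- 1) * ?E s - w s z < \<theta>"
        unfolding split_def
      proof eventually_elim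
        case (elim z)
        then show ?case using E[of "fst z"] by linarith
      qed
    qed
  qed
  then show "selfsimilar a b t (x - c) + selfsimilar a b t (- x - c) - superposition_error a b c t \<le> w t x"
    by simp
qed

theorem theorem3:
  fixes \<sigma>lo \<sigma>hi c t x :: real
    and u v w :: "real \<Rightarrow> real \<Rightarrow> real"
  assumes "0 < \<sigma>lo" and "\<sigma>lo \<le> \<sigma>hi"
    and w: "gheat_cauchy_solution \<sigma>lo \<sigma>hi (\<lambda>y. of_bool (\<bar>y\<bar> > c)) w"
    and u_pos: "\<And>s y. s > 0 \<Longrightarrow> u s y = f_profile \<sigma>lo \<sigma>hi ((y - c) / sqrt s)"
    and u_0: "\<And>y. u 0 y = of_bool (y > c)"
    and v_pos: "\<And>s y. s > 0 \<Longrightarrow> v s y = f_profile \<sigma>lo \<sigma>hi ((- y - c) / sqrt s)"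
    and v_0: "\<And>y. v 0 y = of_bool (y < - c)"
    and "t \<ge> 0" and "c > \<sigma>hi * sqrt t / 2"
  shows "0 \<le> u t x + v t x - w t x \<and>
    u t x + v t x - w t x \<le>
      (if t = 0 then 0
       else 2 * (\<sigma>hi - \<sigma>lo) / \<sigma>hi * std_normal_cdf (- (2 * c) / (\<sigma>hi * sqrt t)))"
proof (cases "t = 0")
  case True
  \<comment> \<open>At time 0 the hypothesis on \<open>c\<close> reduces to positivity, and the
    claim becomes an identity between indicators.\<close>
  then have "c > 0" using assms(9) by simp
  have "w 0 x = of_bool (\<bar>x\<bar> > c)"
    using w by (simp add: gheat_cauchy_solution_def)
  then show ?thesis
    using True \<open>c > 0\<close> by (auto simp: u_0 v_0)
next
  case False
  then have t: "t > 0" using \<open>t \<ge> 0\<close> by simp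
  have "\<sigma>hi * sqrt t < 2 * c" using assms(9) by simp
  from superposition_bounds[OF assms(1,2) t this w, of x] show ?thesis
    using False by (simp add: u_pos[OF t] v_pos[OF t] selfsimilar_def superposition_error_def)
qed

end
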